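(* Let $0<\epsilon<\frac12$ and let $\mathcal{P}$ be a property of functions mapping $\{0,1\}^n\to[0,1]$. If $k\ge1$ is such that for every $f\in\mathcal{P}$ there is a $k$-junta $h:\{0,1\}^n\to[0,1]$ with $\|f-h\|_2\le \frac{\epsilon}{10^6}$, then there is an $\epsilon$-tester for $\mathcal{P}$ in the $\ell_2$ testing model with query complexity $\frac{2^{O(k\log k)}}{\epsilon^{10}}$ (independent of $n$).
   Context: A property $\mathcal{P}$ of functions $\{0,1\}^n\to[0,1]$ is a subset of these functions that is invariant under relabeling (permuting) the $n$ coordinates. A function $h$ is a $k$-junta if there is $J\subseteq[n]$, $|J|\le k$, such that $h(x)=h(y)$ whenever $x_i=y_i$ for all $i\in J$. $\|f-g\|_2=(\mathbb{E}_x[(f(x)-g(x))^2])^{1/2}$ with $x$ uniform on $\{0,1\}^n$, and $\mathrm{dist}_2(f,\mathcal{P})=\inf_{g\in\mathcal{P}}\|f-g\|_2$. An $\epsilon$-tester for $\mathcal{P}$ in the $\ell_2$ testing model is a randomized algorithm with oracle access to $f$ that accepts every $f\in\mathcal{P}$ with probability at least $2/3$ and rejects every $f$ with $\mathrm{dist}_2(f,\mathcal{P})\ge\epsilon$ with probability at least $2/3$; its query complexity is the number of oracle queries it makes. *)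

theory Defs
  imports
    "HOL-Probability.Probability"
    "HOL-Combinatorics.Permutations"
    "HOL-Library.Landau_Symbols"
begin

type_synonym point = "nat \<Rightarrow> bool"
type_synonym bfun = "point \<Rightarrow> real"

definition cube :: "nat \<Rightarrow> point set" where
  "cube n = {..<n} \<rightarrow>\<^sub>E (UNIV :: bool set)"

(* Extensional (value undefined off the cube), so that HOL equality of elements is equality
   of functions on {0,1}^n. *)
definition bfuns :: "nat \<Rightarrow> bfun set" where
  "bfuns n = cube n \<rightarrow>\<^sub>E {0..1}"

definition relabel :: "nat \<Rightarrow> (nat \<Rightarrow> nat) \<Rightarrow> bfun \<Rightarrow> bfun" where
  "relabel n \<pi> f = restrict (\<lambda>x. f (x \<circ> \<pi>)) (cube n)"

definition is_property :: "nat \<Rightarrow> bfun set \<Rightarrow> bool" where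
  "is_property n P \<longleftrightarrow>
     P \<subseteq> bfuns n \<and> (\<forall>\<pi> f. \<pi> permutes {..<n} \<longrightarrow> f \<in> P \<longrightarrow> relabel n \<pi> f \<in> P)"

definition junta :: "nat \<Rightarrow> nat \<Rightarrow> bfun \<Rightarrow> bool" where
  "junta n k h \<longleftrightarrow>
     (\<exists>J. J \<subseteq> {..<n} \<and> card J \<le> k \<and>
        (\<forall>x\<in>cube n. \<forall>y\<in>cube n. (\<forall>i\<in>J. x i = y i) \<longrightarrow> h x = h y))"

definition l2_dist :: "nat \<Rightarrow> bfun \<Rightarrow> bfun \<Rightarrow> real" where
  "l2_dist n f g =
     sqrt (measure_pmf.expectation (pmf_of_set (cube n)) (\<lambda>x. (f x - g x)\<^sup>2))"

(* Extended-real valued, so that the distance to the empty property is infinity; the real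
   Inf of the empty set is an unspecified number. *)
definition dist2 :: "nat \<Rightarrow> bfun \<Rightarrow> bfun set \<Rightarrow> ereal" where
  "dist2 n f P = (INF g\<in>P. ereal (l2_dist n f g))"

(* A deterministic adaptive oracle algorithm: Query x c asks for f x and continues with
   c (f x); Output True is acceptance. *)
datatype query_alg = Output bool | Query point "real \<Rightarrow> query_alg"

primrec accepts :: "bfun \<Rightarrow> query_alg \<Rightarrow> bool" where
  "accepts f (Output b) = b"
| "accepts f (Query x c) = accepts f (c (f x))"

primrec queried :: "bfun \<Rightarrow> query_alg \<Rightarrow> point list" where
  "queried f (Output b) = []"
| "queried f (Query x c) = x # queried f (c (f x))"

(* A randomized algorithm is a probability distribution over deterministic ones; all its
   random choices are drawn before the first query, which is no loss of generality. *)
type_synonym rand_alg = "query_alg pmf"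

definition valid_alg :: "nat \<Rightarrow> rand_alg \<Rightarrow> bool" where
  "valid_alg n T \<longleftrightarrow> (\<forall>t\<in>set_pmf T. \<forall>f\<in>bfuns n. set (queried f t) \<subseteq> cube n)"

definition accept_prob :: "rand_alg \<Rightarrow> bfun \<Rightarrow> real" where
  "accept_prob T f = measure_pmf.prob T {t. accepts f t}"

definition reject_prob :: "rand_alg \<Rightarrow> bfun \<Rightarrow> real" where
  "reject_prob T f = measure_pmf.prob T {t. \<not> accepts f t}"

definition is_tester :: "nat \<Rightarrow> real \<Rightarrow> bfun set \<Rightarrow> rand_alg \<Rightarrow> bool" where
  "is_tester n \<epsilon> P T \<longleftrightarrow>
     valid_alg n T \<and>
     (\<forall>f\<in>P. accept_prob T f \<ge> 2 / 3) \<and>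
     (\<forall>f\<in>bfuns n. dist2 n f P \<ge> ereal \<epsilon> \<longrightarrow> reject_prob T f \<ge> 2 / 3)"

(* Worst case over the oracle and the internal randomness; repeated queries are counted. *)
definition query_complexity :: "nat \<Rightarrow> rand_alg \<Rightarrow> ereal" where
  "query_complexity n T =
     (SUP t\<in>set_pmf T. SUP f\<in>bfuns n. ereal (real (length (queried f t))))"

end

(* Proof idea. Put \<eta> = (\<epsilon> / 10^6)^2, split the n coordinates at random into s = O(k^3) parts and run two tests.

   The influence test looks for k parts such that resampling f outside their union S hardly changes f. For f in P it
   accepts since f is close to a junta. Let D(S) be the mean squared change. Then D(S \<inter> T) \<le> 2 D(S) + 2 D(T), so if
   D(J) is large for every J of size at most k, the sets with small D form a (k+1)-intersecting family. Such a family
   has q-biased measure at most (q / (1-q))^(k+1), so it is unlikely to contain a union of k random parts.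
   Hence acceptance forces f to be close to a k-junta h, with a loss that does not depend on k.

   The core test queries f at points that are constant on the parts. It compares the answers with all placements of
   k-juntas close to P among the parts. By Markov's inequality the answers agree on average with those of h. The strings
   assigned to the parts form a fixed design whose restriction to any 2k parts is almost uniform. So two juntas that agree
   on the design agree on average, and after a permutation of the coordinates h is close to P, and so is f. *)
theory Submission
  imports Defs
begin

subsection \<open>Finite probability spaces\<close>

text \<open>The hypothesis allows an error of \<open>\<epsilon> / 10 ^ 6\<close> with an absolute
  constant, so no step may lose a factor that grows with \<open>k\<close> or \<open>n\<close>.
  Discarding irrelevant parts one after another would lose a factor \<open>k\<close>. Here a single
  intersection is taken, which costs a factor 4, and the intersection property of the whole family
  does the rest. The exponent k + 1 is decisive: letting the k parts vary costs about (s / b)^k for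
  an auxiliary size b, while the measure bound gives about (b / s)^(k + 1), so one factor b / s
  survives. The second obstacle is that the relevant coordinates of the junta stay unknown. On
  points constant on the parts, h is seen only through the parts holding its variables; this
  suffices because \<open>P\<close> is invariant under relabelling. Every use of Markov's inequality
  costs a factor 20 for a failure probability of 1/20. The squared errors add up to 1386483 times
  \<open>\<eta>\<close>, well below \<open>10 ^ 12 * \<eta>\<close>, which is the square of
  \<open>\<epsilon>\<close>. Sampling at accuracy of order \<open>\<eta>\<close> needs about
  \<epsilon>^(-4) samples up to factors in \<open>k\<close>.\<close>

lemma map_pmf_of_set_equal_fibres:
  assumes "finite S" "S \<noteq> {}" "f ` S = T"
    and "\<And>y. y \<in> T \<Longrightarrow> card {x \<in> S. f x = y} = c"
  shows "map_pmf f (pmf_of_set S) = pmf_of_set T"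
proof (rule pmf_eqI)
  fix y
  have fT: "finite T" "T \<noteq> {}" using assms by auto
  have "card S = (\<Sum>y\<in>T. card {x \<in> S. f x = y})"
    using assms(1,3) card_eq_sum sum.group[of S T f "\<lambda>_. 1::nat"] fT by simp
  then have S: "card S = card T * c" using assms(4) by simp
  then have "c > 0" using assms(1,2) by (metis card_gt_0_iff mult_0_right not_gr_zero)
  have "pmf (map_pmf f (pmf_of_set S)) y = real (card {x \<in> S. f x = y}) / card S"
    using assms(1,2) by (simp add: pmf_map measure_pmf_of_set vimage_def Int_def)
  also have "\<dots> = pmf (pmf_of_set T) y"
  proof (cases "y \<in> T")
    case True
    then show ?thesis using assms(4)[of y] S \<open>c > 0\<close> fT by simp
  next
    case False
    then have "{x \<in> S. f x = y} = {}" using assms(3) by auto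
    with False fT show ?thesis by (simp only: card.empty) simp
  qed
  finally show "pmf (map_pmf f (pmf_of_set S)) y = pmf (pmf_of_set T) y" .
qed

lemma prob_pair_pmf_le:
  assumes "\<And>a. a \<in> set_pmf p \<Longrightarrow> measure_pmf.prob q {b. Q a b} \<le> c"
  shows "measure_pmf.prob (pair_pmf p q) {(a, b). Q a b} \<le> c"
proof -
  obtain a where a: "a \<in> set_pmf p" using set_pmf_not_empty by fast
  have c0: "0 \<le> c" using assms[OF a] measure_nonneg order_trans by blast
  have "emeasure (pair_pmf p q) {(a, b). Q a b}
     = (\<integral>\<^sup>+a. \<integral>\<^sup>+b. indicator {(a, b). Q a b} (a, b) \<partial>q \<partial>p)"
    by (simp add: nn_integral_pair_pmf' flip: nn_integral_indicator)
  also have "\<dots> = (\<integral>\<^sup>+a. emeasure q {b. Q a b} \<partial>p)"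
    by (intro nn_integral_cong)
       (simp flip: nn_integral_indicator add: indicator_def of_bool_def)
  also have "\<dots> \<le> (\<integral>\<^sup>+a. ennreal c \<partial>p)"
    using assms by (intro nn_integral_mono_AE)
       (auto simp: AE_measure_pmf_iff measure_pmf.emeasure_eq_measure c0 intro!: ennreal_leI)
  also have "\<dots> = ennreal c" by simp
  finally show ?thesis using c0 by (simp add: measure_pmf.emeasure_eq_measure)
qed

lemma prob_pair_pmf_fst:
  "measure_pmf.prob (pair_pmf p q) {(a, b). Q a} = measure_pmf.prob p {a. Q a}"
proof -
  have "measure_pmf.prob p {a. Q a} = measure_pmf.prob (map_pmf fst (pair_pmf p q)) {a. Q a}"
    by (simp add: map_fst_pair_pmf)
  also have "\<dots> = measure_pmf.prob (pair_pmf p q) {(a, b). Q a}"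
    by (auto simp: vimage_def intro!: arg_cong[where f="measure_pmf.prob _"])
  finally show ?thesis by simp
qed

lemma markov_pmf:
  fixes X :: "'a \<Rightarrow> real"
  assumes "finite (set_pmf p)" "\<And>a. a \<in> set_pmf p \<Longrightarrow> 0 \<le> X a" "0 < t"
    and "measure_pmf.expectation p X \<le> c * t"
  shows "measure_pmf.prob p {a. X a > t} \<le> c"
proof -
  have "measure_pmf.prob p {a. X a > t} \<le> measure_pmf.prob p {a \<in> space (measure_pmf p). X a \<ge> t}"
    by (intro measure_pmf.finite_measure_mono) auto
  also have "\<dots> \<le> measure_pmf.expectation p X / t"
    using assms by (intro integral_Markov_inequality_measure[where A="{}"] integrable_measure_pmf_finite)
       (auto simp: AE_measure_pmf_iff)
  also have "\<dots> \<le> c" using assms(3,4) by (simp add: divide_le_eq)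
  finally show ?thesis .
qed

text \<open>The mean enters only through a lower bound \<open>\<mu>\<close>, because neither
  application (pattern frequencies of a design, samples of the influence test) knows the mean
  itself.\<close>

lemma hoeffding_Pi_pmf:
  fixes X :: "'a \<Rightarrow> real"
  assumes "\<And>a. a \<in> set_pmf p \<Longrightarrow> X a \<in> {0..1}"
    and "\<mu> \<le> measure_pmf.expectation p X" "0 \<le> \<tau>" "0 < m"
  shows "measure_pmf.prob (Pi_pmf {..<m} d (\<lambda>_. p)) {W. (\<Sum>i<m. X (W i)) \<le> real m * (\<mu> - \<tau>)}
          \<le> exp (- 2 * real m * \<tau>\<^sup>2)"
proof -
  let ?R = "Pi_pmf {..<m} d (\<lambda>_. p)"
  have comp: "map_pmf (\<lambda>W. W i) ?R = p" if "i < m" for i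
    using that by (simp add: Pi_pmf_component)
  have ex: "measure_pmf.expectation ?R (\<lambda>W. X (W i)) = measure_pmf.expectation p X" if "i < m" for i
  proof -
    have "measure_pmf.expectation (map_pmf (\<lambda>W. W i) ?R) X = measure_pmf.expectation ?R (\<lambda>W. X (W i))"
      by (rule integral_map_pmf)
    then show ?thesis by (simp only: comp[OF that])
  qed
  have "prob_space.indep_vars (measure_pmf ?R) (\<lambda>_. borel) (\<lambda>i W. X (W i)) {..<m}"
  proof -
    have "prob_space.indep_vars (measure_pmf ?R) (\<lambda>_. count_space UNIV) (\<lambda>i W. W i) {..<m}"
      by (intro indep_vars_Pi_pmf) auto
    from prob_space.indep_vars_compose2[OF measure_pmf.prob_space_axioms this, of "\<lambda>_. X" "\<lambda>_. borel"] show ?thesis by simp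
  qed
  moreover have "AE W in measure_pmf ?R. X (W i) \<in> {0..1}" if "i < m" for i
  proof -
    have "W i \<in> set_pmf p" if "W \<in> set_pmf ?R" for W
      using that \<open>i < m\<close> by (auto simp: set_Pi_pmf PiE_dflt_def)
    then show ?thesis using assms(1) by (auto simp: AE_measure_pmf_iff)
  qed
  ultimately interpret H: Hoeffding_ineq "measure_pmf ?R" "{..<m}" "\<lambda>i W. X (W i)" "\<lambda>_. 0" "\<lambda>_. 1"
      "real m * measure_pmf.expectation p X"
    by unfold_locales (auto simp: ex)
  have "measure_pmf.prob ?R {W. (\<Sum>i<m. X (W i)) \<le> real m * (\<mu> - \<tau>)}
     \<le> measure_pmf.prob ?R {W \<in> space (measure_pmf ?R).
           (\<Sum>i<m. X (W i)) \<le> real m * measure_pmf.expectation p X - real m * \<tau>}"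
  proof (intro measure_pmf.finite_measure_mono subsetI)
    fix W assume "W \<in> {W. (\<Sum>i<m. X (W i)) \<le> real m * (\<mu> - \<tau>)}"
    moreover have "real m * \<mu> \<le> real m * measure_pmf.expectation p X"
      using assms(2) by (intro mult_left_mono) auto
    ultimately show "W \<in> {W \<in> space (measure_pmf ?R).
           (\<Sum>i<m. X (W i)) \<le> real m * measure_pmf.expectation p X - real m * \<tau>}"
      by (simp add: right_diff_distrib)
  qed auto
  also have "\<dots> \<le> exp (- 2 * (real m * \<tau>)\<^sup>2 / (\<Sum>i<m. (1 - 0 :: real)\<^sup>2))"
    using assms(3,4) by (intro H.Hoeffding_ineq_le) auto
  also have "- 2 * (real m * \<tau>)\<^sup>2 / (\<Sum>i<m. (1 - 0 :: real)\<^sup>2) = - 2 * real m * \<tau>\<^sup>2"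
    using assms(4) by (simp add: power2_eq_square field_simps)
  finally show ?thesis .
qed

subsection \<open>Biased measures of intersecting families\<close>

text \<open>The bound \<open>(q / (1 - q)) ^ t\<close> below is the hitting probability of Frankl's random walk. Stated for products of
  cross-intersecting families it needs no shifting: splitting off one coordinate reduces it to \<open>walk_step\<close>, where
  \<open>B\<close> and \<open>B / r\<close> are the bounds for \<open>t\<close> and \<open>t - 1\<close> and \<open>r = (q / (1 - q))\<^sup>2\<close> is exactly the ratio for which the
  convexity argument closes.\<close>

definition biased :: "real \<Rightarrow> nat \<Rightarrow> (nat set \<Rightarrow> bool) \<Rightarrow> real" where
  "biased q n F = (\<Sum>S | S \<subseteq> {..<n} \<and> F S. q ^ card S * (1 - q) ^ (n - card S))"

lemma biased_nonneg: "0 \<le> q \<Longrightarrow> q \<le> 1 \<Longrightarrow> 0 \<le> biased q n F"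
  unfolding biased_def by (intro sum_nonneg) auto

lemma biased_Suc:
  "biased q (Suc n) F = (1 - q) * biased q n F + q * biased q n (\<lambda>S. F (insert n S))"
proof -
  let ?w = "\<lambda>n S. q ^ card S * (1 - q) ^ (n - card S)"
  let ?A = "{S. S \<subseteq> {..<n} \<and> F S}" and ?B = "{S. S \<subseteq> {..<n} \<and> F (insert n S)}"
  have eq: "{S. S \<subseteq> {..<Suc n} \<and> F S} = ?A \<union> insert n ` ?B"
  proof (intro equalityI subsetI)
    fix S assume S: "S \<in> {S. S \<subseteq> {..<Suc n} \<and> F S}"
    show "S \<in> ?A \<union> insert n ` ?B"
    proof (cases "n \<in> S")
      case True
      then have "S = insert n (S - {n})" "S - {n} \<in> ?B" using S by (auto simp: insert_absorb less_Suc_eq)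
      then show ?thesis by blast
    next
      case False
      then show ?thesis using S by (auto simp: less_Suc_eq)
    qed
  qed auto
  have disj: "?A \<inter> insert n ` ?B = {}" by auto
  have inj: "inj_on (insert n) ?B"
    by (rule inj_onI) (metis (mono_tags, lifting) Diff_insert_absorb lessThan_iff less_irrefl mem_Collect_eq subsetD)
  have cle: "card S \<le> n" if "S \<subseteq> {..<n}" for S using card_mono[OF _ that] by simp
  have wA: "?w (Suc n) S = (1 - q) * ?w n S" if "S \<in> ?A" for S
    using cle[of S] that by (simp add: Suc_diff_le)
  have wB: "?w (Suc n) (insert n S) = q * ?w n S" if "S \<in> ?B" for S
  proof -
    have "finite S" "n \<notin> S" using that finite_subset by auto
    then show ?thesis by simp
  qed
  have "biased q (Suc n) F = sum (?w (Suc n)) ?A + sum (?w (Suc n)) (insert n ` ?B)"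
    unfolding biased_def eq by (rule sum.union_disjoint) (use disj in auto)
  also have "sum (?w (Suc n)) (insert n ` ?B) = (\<Sum>S\<in>?B. q * ?w n S)"
    using inj wB by (simp add: sum.reindex)
  also have "sum (?w (Suc n)) ?A = (\<Sum>S\<in>?A. (1 - q) * ?w n S)"
    by (intro sum.cong refl wA)
  finally show ?thesis by (simp add: biased_def sum_distrib_left)
qed

lemma biased_le_1:
  assumes "0 \<le> q" "q \<le> 1" shows "biased q n F \<le> 1"
proof (induction n arbitrary: F)
  case 0
  have "{S. S = {} \<and> F S} = (if F {} then {{}} else {})" by auto
  then show ?case by (simp add: biased_def)
next
  case (Suc n)
  have "biased q (Suc n) F \<le> (1 - q) * 1 + q * 1"
    unfolding biased_Suc by (intro add_mono mult_left_mono Suc) (use assms in auto)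
  then show ?case by simp
qed

lemma walk_step:
  fixes q :: real
  assumes q: "0 < q" "q < 1" and r: "r = (q / (1 - q))\<^sup>2" and B: "0 < B"
    and nn: "0 \<le> f0" "0 \<le> f1" "0 \<le> g0" "0 \<le> g1"
    and h: "f0 * g0 \<le> B" "f0 * g1 \<le> B" "f1 * g0 \<le> B" "r * (f1 * g1) \<le> B"
  shows "((1 - q) * f0 + q * f1) * ((1 - q) * g0 + q * g1) \<le> B"
proof (cases "f1 * g1 \<le> B")
  case True
  have "((1 - q) * f0 + q * f1) * ((1 - q) * g0 + q * g1)
     = (1-q)\<^sup>2 * (f0*g0) + q*(1-q)*(f0*g1) + q*(1-q)*(f1*g0) + q\<^sup>2 * (f1*g1)"
    by (simp add: algebra_simps power2_eq_square)
  also have "\<dots> \<le> (1-q)\<^sup>2 * B + q*(1-q)*B + q*(1-q)*B + q\<^sup>2 * B"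
    using q h True by (intro add_mono mult_left_mono) auto
  also have "\<dots> = B" by (simp add: algebra_simps power2_eq_square)
  finally show ?thesis .
next
  case False
  define u where "u = f1 * g1"
  have u: "u > B" "u > 0" using False B by (auto simp: u_def)
  \<comment> \<open>When \<open>f1 * g1\<close> exceeds \<open>B\<close>, this identity forces
    \<open>f0 * g0\<close> down to at most \<open>B * B / u\<close>, which compensates for the large
    product.\<close>
  have "(f0 * g0) * u = (f0 * g1) * (f1 * g0)" by (simp add: u_def)
  also have "\<dots> \<le> B * B" using h nn B by (intro mult_mono) auto
  finally have a: "(f0 * g0) * u \<le> B * B" .
  define c where "c = q / (1 - q)"
  have c: "c > 0" "q = c * (1 - q)" using q by (auto simp: c_def)
  have cu: "c\<^sup>2 * u \<le> B" using h(4) r by (simp add: u_def c_def)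
  \<comment> \<open>Here u lies between \<open>B\<close> and \<open>B / c\<^sup>2\<close>. The
    convex function \<open>B * B / u + c\<^sup>2 * u\<close> is at most
    \<open>(1 + c\<^sup>2) * B\<close> at both ends, hence also in between. With the two mixed terms
    the total becomes a perfect square times \<open>B\<close>.\<close>
  have "0 \<le> (u - B) * (B - c\<^sup>2 * u)" using u cu by simp
  then have conv: "B * B + c\<^sup>2 * u * u \<le> (1 + c\<^sup>2) * B * u" by (simp add: algebra_simps)
  have "u * (((1 - q) * f0 + q * f1) * ((1 - q) * g0 + q * g1))
     = (1-q)\<^sup>2 * ((f0*g0)*u + c*(f0*g1)*u + c*(f1*g0)*u + c\<^sup>2 * u * u)"
  proof -
    have e: "(1 - q) * a + q * b = (1 - q) * (a + c * b)" for a b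
      using q by (simp add: c_def field_simps)
    show ?thesis unfolding e by (simp add: algebra_simps power2_eq_square u_def)
  qed
  also have "\<dots> \<le> (1-q)\<^sup>2 * (B*B + c*B*u + c*B*u + c\<^sup>2 * u * u)"
    using a c u h by (intro mult_left_mono add_mono mult_right_mono) auto
  also have "\<dots> \<le> (1-q)\<^sup>2 * ((1 + c\<^sup>2) * B * u + 2*c*B*u)"
    using conv by (intro mult_left_mono) auto
  also have "\<dots> = ((1-q) + (1-q)*c)\<^sup>2 * (B * u)" by (simp add: algebra_simps power2_eq_square)
  also have "(1-q) + (1-q)*c = 1" using q by (simp add: c_def)
  finally show ?thesis using u(2) by (simp add: mult.commute)
qed

lemma cross_intersecting_biased:
  fixes q :: real
  assumes "0 < q" "q \<le> 1 / 2"
    and "\<And>S T. S \<subseteq> {..<n} \<Longrightarrow> T \<subseteq> {..<n} \<Longrightarrow> F S \<Longrightarrow> G T \<Longrightarrow> t \<le> card (S \<inter> T)"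
  shows "biased q n F * biased q n G \<le> (q / (1 - q)) ^ (2 * t)"
  using assms(3)
proof (induction n arbitrary: F G t)
  case 0
  show ?case
  proof (cases "t = 0")
    case True
    then show ?thesis using assms(1,2) biased_le_1[of q 0] biased_nonneg[of q 0] by (simp add: mult_le_one)
  next
    case False
    then have "\<not> F {} \<or> \<not> G {}" using 0[of "{}" "{}"] by auto
    then have "biased q 0 F = 0 \<or> biased q 0 G = 0" by (auto simp: biased_def)
    then show ?thesis using assms(1,2) by auto
  qed
next
  case (Suc n)
  show ?case
  proof (cases "t = 0")
    case True
    then show ?thesis using assms(1,2) biased_le_1[of q "Suc n"] biased_nonneg[of q "Suc n"]
      by (simp add: mult_le_one)
  next
    case False
    then obtain t' where t': "t = Suc t'" by (cases t) auto
    let ?F = "\<lambda>S. F (insert n S)" and ?G = "\<lambda>S. G (insert n S)"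
    let ?c = "q / (1 - q)"
    have c: "0 < ?c" using assms(1,2) by auto
    have fin: "finite S" "n \<notin> S" if "S \<subseteq> {..<n}" for S using that finite_subset by auto
    have sub: "S \<subseteq> {..<Suc n}" "insert n S \<subseteq> {..<Suc n}" if "S \<subseteq> {..<n}" for S using that by auto
    have 1: "biased q n F * biased q n G \<le> ?c ^ (2 * t)"
      by (rule Suc.IH) (rule Suc.prems[OF sub(1) sub(1)])
    have 2: "biased q n F * biased q n ?G \<le> ?c ^ (2 * t)"
    proof (rule Suc.IH)
      fix S T assume *: "S \<subseteq> {..<n}" "T \<subseteq> {..<n}" "F S" "G (insert n T)"
      have "t \<le> card (S \<inter> insert n T)"
        by (rule Suc.prems[OF sub(1)[OF *(1)] sub(2)[OF *(2)] *(3,4)])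
      then show "t \<le> card (S \<inter> T)" using fin[OF *(1)] by simp
    qed
    have 3: "biased q n ?F * biased q n G \<le> ?c ^ (2 * t)"
    proof (rule Suc.IH)
      fix S T assume *: "S \<subseteq> {..<n}" "T \<subseteq> {..<n}" "F (insert n S)" "G T"
      have "t \<le> card (insert n S \<inter> T)"
        by (rule Suc.prems[OF sub(2)[OF *(1)] sub(1)[OF *(2)] *(3,4)])
      then show "t \<le> card (S \<inter> T)" using fin[OF *(2)] by simp
    qed
    \<comment> \<open>Only when both sets contain \<open>n\<close> does this element account for one
      unit of the intersection, so only here the induction is applied with \<open>t'\<close>. The
      factor \<open>?c\<^sup>2\<close> in \<open>walk_step\<close> restores the exponent.\<close>
    have 4: "biased q n ?F * biased q n ?G \<le> ?c ^ (2 * t')"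
    proof (rule Suc.IH)
      fix S T assume *: "S \<subseteq> {..<n}" "T \<subseteq> {..<n}" "F (insert n S)" "G (insert n T)"
      have "t \<le> card (insert n S \<inter> insert n T)"
        by (rule Suc.prems[OF sub(2)[OF *(1)] sub(2)[OF *(2)] *(3,4)])
      also have "insert n S \<inter> insert n T = insert n (S \<inter> T)" by auto
      also have "card \<dots> = Suc (card (S \<inter> T))" using fin[OF *(1)] by simp
      finally show "t' \<le> card (S \<inter> T)" by (simp add: t')
    qed
    have 5: "?c\<^sup>2 * (biased q n ?F * biased q n ?G) \<le> ?c ^ (2 * t)"
    proof -
      have "?c\<^sup>2 * (biased q n ?F * biased q n ?G) \<le> ?c\<^sup>2 * ?c ^ (2 * t')"
        by (rule mult_left_mono[OF 4]) simp
      also have "\<dots> = ?c ^ (2 + 2 * t')" by (simp only: power_add)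
      finally show ?thesis by (simp add: t')
    qed
    show ?thesis
      unfolding biased_Suc
      by (rule walk_step[OF _ _ refl _ _ _ _ _ 1 2 3 5])
         (use assms(1,2) c biased_nonneg[of q n] in auto)
  qed
qed

corollary intersecting_biased:
  fixes q :: real
  assumes "0 < q" "q \<le> 1 / 2"
    and "\<And>S T. S \<subseteq> {..<n} \<Longrightarrow> T \<subseteq> {..<n} \<Longrightarrow> F S \<Longrightarrow> F T \<Longrightarrow> t \<le> card (S \<inter> T)"
  shows "biased q n F \<le> (q / (1 - q)) ^ t"
proof -
  have "(biased q n F)\<^sup>2 \<le> ((q / (1 - q)) ^ t)\<^sup>2"
    using cross_intersecting_biased[OF assms(1,2), where F=F and G=F and n=n and t=t] assms(3)
    by (simp add: power2_eq_square mult_2 power_add)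
  then show ?thesis by (rule power2_le_imp_le) (use assms(1,2) in auto)
qed

subsection \<open>Averages over the cube and resampling\<close>

text \<open>All couplings of uniform points are realised by reading off distinct coordinates of one uniform point
  of a larger cube.\<close>

definition sub :: "nat \<Rightarrow> (nat \<Rightarrow> nat) \<Rightarrow> point \<Rightarrow> point" where
  "sub n \<iota> w = (\<lambda>j\<in>{..<n}. w (\<iota> j))"

definition cube_avg :: "nat \<Rightarrow> bfun \<Rightarrow> real" where
  "cube_avg n q = measure_pmf.expectation (pmf_of_set (cube n)) q"

text \<open>A point of \<open>cube (2 * n)\<close> encodes two points \<open>x\<close> and \<open>z\<close> of \<open>cube n\<close>, and \<open>mix n S\<close> selects the coordinates of \<open>x\<close> on \<open>S\<close> and those
  of \<open>z\<close> off \<open>S\<close>. So \<open>dev n f S\<close> is twice the mean conditional variance of \<open>f\<close> given the coordinates in \<open>S\<close>.\<close>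

definition mix :: "nat \<Rightarrow> nat set \<Rightarrow> nat \<Rightarrow> nat" where
  "mix n S j = (if j \<in> S then j else n + j)"

definition dev :: "nat \<Rightarrow> bfun \<Rightarrow> nat set \<Rightarrow> real" where
  "dev n f S = cube_avg (2 * n) (\<lambda>w. (f (sub n id w) - f (sub n (mix n S) w))\<^sup>2)"

definition depends_on :: "nat \<Rightarrow> nat set \<Rightarrow> bfun \<Rightarrow> bool" where
  "depends_on n J h \<longleftrightarrow> (\<forall>x\<in>cube n. \<forall>y\<in>cube n. (\<forall>i\<in>J. x i = y i) \<longrightarrow> h x = h y)"

lemma finite_cube [simp]: "finite (cube n)"
  by (simp add: cube_def finite_PiE)

lemma cube_nonempty [simp]: "cube n \<noteq> {}"
  by (simp add: cube_def PiE_eq_empty_iff)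

lemma card_cube: "card (cube n) = 2 ^ n"
  by (simp add: cube_def card_PiE)

lemma sub_in_cube [simp]: "sub n \<iota> w \<in> cube n"
  by (simp add: sub_def cube_def)

lemma sub_apply: "j < n \<Longrightarrow> sub n \<iota> w j = w (\<iota> j)"
  by (simp add: sub_def)

lemma sub_sub: "(\<And>j. j < n \<Longrightarrow> \<iota> j < N) \<Longrightarrow> sub n \<iota> (sub N \<kappa> w) = sub n (\<kappa> \<circ> \<iota>) w"
  by (auto simp: sub_def restrict_def fun_eq_iff)

lemma sub_cong: "(\<And>j. j < n \<Longrightarrow> w (\<iota> j) = w' (\<kappa> j)) \<Longrightarrow> sub n \<iota> w = sub n \<kappa> w'"
  by (auto simp: sub_def restrict_def fun_eq_iff)

lemma sub_id [simp]: "x \<in> cube n \<Longrightarrow> sub n id x = x"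
  by (simp add: sub_def cube_def PiE_restrict)

lemma cube_avg_sum: "cube_avg n q = (\<Sum>x\<in>cube n. q x) / 2 ^ n"
  by (simp add: cube_avg_def integral_pmf_of_set card_cube)

lemma cube_avg_mono: "(\<And>x. x \<in> cube n \<Longrightarrow> q x \<le> r x) \<Longrightarrow> cube_avg n q \<le> cube_avg n r"
  by (simp add: cube_avg_sum divide_right_mono sum_mono)

lemma cube_avg_cong: "(\<And>x. x \<in> cube n \<Longrightarrow> q x = r x) \<Longrightarrow> cube_avg n q = cube_avg n r"
  by (simp add: cube_avg_sum)

lemma cube_avg_add: "cube_avg n (\<lambda>x. q x + r x) = cube_avg n q + cube_avg n r"
  by (simp add: cube_avg_sum sum.distrib add_divide_distrib)

lemma cube_avg_cmult: "cube_avg n (\<lambda>x. c * q x) = c * cube_avg n q"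
  by (simp add: cube_avg_sum sum_distrib_left)

text \<open>A fibre prescribes the bits in the image of \<open>\<iota>\<close> and leaves the others
  free, so all fibres have the same size. Injectivity keeps the prescriptions consistent.\<close>

lemma map_pmf_sub:
  assumes "inj_on \<iota> {..<n}" "\<iota> ` {..<n} \<subseteq> {..<N}"
  shows "map_pmf (sub n \<iota>) (pmf_of_set (cube N)) = pmf_of_set (cube n)"
proof -
  let ?inv = "the_inv_into {..<n} \<iota>"
  let ?B = "\<lambda>x i. if i \<in> \<iota> ` {..<n} then {x (?inv i)} else (UNIV :: bool set)"
  have inv: "?inv (\<iota> j) = j" if "j < n" for j
    using the_inv_into_f_f[OF assms(1)] that by simp
  have fibre: "{w \<in> cube N. sub n \<iota> w = x} = PiE {..<N} (?B x)" if x: "x \<in> cube n" for x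
  proof (intro equalityI subsetI)
    fix w assume "w \<in> {w \<in> cube N. sub n \<iota> w = x}"
    then show "w \<in> PiE {..<N} (?B x)"
      by (auto simp: cube_def PiE_def Pi_def sub_def inv)
  next
    fix w assume w: "w \<in> PiE {..<N} (?B x)"
    have "w (\<iota> j) = x j" if "j < n" for j
    proof -
      have "\<iota> j \<in> {..<N}" using assms(2) that by auto
      from PiE_mem[OF w this] show ?thesis using that by (auto simp: inv)
    qed
    then have "sub n \<iota> w = sub n id x" by (intro sub_cong) simp
    then show "w \<in> {w \<in> cube N. sub n \<iota> w = x}"
      using w x by (auto simp: cube_def PiE_def)
  qed
  have card: "card {w \<in> cube N. sub n \<iota> w = x} = (\<Prod>i<N. if i \<in> \<iota> ` {..<n} then 1 else 2)"
    if "x \<in> cube n" for x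
    unfolding fibre[OF that] by (subst card_PiE) (auto intro!: prod.cong)
  have "sub n \<iota> ` cube N = cube n"
  proof (intro equalityI subsetI)
    fix x assume "x \<in> cube n"
    then have "card {w \<in> cube N. sub n \<iota> w = x} \<noteq> 0" by (simp only: card) (simp add: prod_zero_iff)
    then have "{w \<in> cube N. sub n \<iota> w = x} \<noteq> {}" by force
    then show "x \<in> sub n \<iota> ` cube N" by auto
  qed auto
  then show ?thesis
    by (intro map_pmf_of_set_equal_fibres[where c="\<Prod>i<N. if i \<in> \<iota> ` {..<n} then 1 else 2"] card) auto
qed

lemma cube_avg_sub:
  assumes "inj_on \<iota> {..<n}" "\<iota> ` {..<n} \<subseteq> {..<N}"
  shows "cube_avg N (\<lambda>w. q (sub n \<iota> w)) = cube_avg n q"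
proof -
  have "cube_avg n q = measure_pmf.expectation (map_pmf (sub n \<iota>) (pmf_of_set (cube N))) q"
    by (simp only: map_pmf_sub[OF assms] cube_avg_def)
  also have "\<dots> = cube_avg N (\<lambda>w. q (sub n \<iota> w))"
    unfolding cube_avg_def by (rule integral_map_pmf)
  finally show ?thesis ..
qed

section \<open>Random labellings and balanced strings\<close>

definition labellings :: "nat \<Rightarrow> nat \<Rightarrow> (nat \<Rightarrow> nat) set" where
  "labellings n s = ({..<n} \<rightarrow>\<^sub>E {..<s})"

lemma finite_labellings [simp]: "finite (labellings n s)"
  by (simp add: labellings_def finite_PiE)

lemma labellings_nonempty: "0 < s \<Longrightarrow> labellings n s \<noteq> {}"
  by (auto simp: labellings_def PiE_eq_empty_iff)

lemma card_labellings: "card (labellings n s) = s ^ n"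
  by (simp add: labellings_def card_PiE)

definition balanced :: "nat \<Rightarrow> point set" where
  "balanced s = {y \<in> cube s. 2 * card {i. i < s \<and> y i} = s}"

text \<open>A uniform label hits a one of \<open>y\<close> with probability exactly 1/2, and labels
  of distinct coordinates are independent. In terms of counting, each of the \<open>n\<close>
  coordinates has \<open>s div 2\<close> admissible labels, whatever bit is prescribed.\<close>

lemma map_pmf_balanced:
  assumes "y \<in> balanced s" "0 < s"
  shows "map_pmf (\<lambda>\<phi>. sub n \<phi> y) (pmf_of_set (labellings n s)) = pmf_of_set (cube n)"
proof -
  have half: "card {i. i < s \<and> y i = b} = s div 2" for b
  proof (cases b)
    case True
    have "2 * card {i. i < s \<and> y i} = s" using assms(1) by (simp add: balanced_def)
    then show ?thesis using True by simp
  next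
    case False
    have "{i. i < s \<and> y i = b} = {..<s} - {i. i < s \<and> y i}" using False by auto
    then have "card {i. i < s \<and> y i = b} = s - card {i. i < s \<and> y i}"
      by (simp only:) (subst card_Diff_subset, auto)
    moreover have "2 * card {i. i < s \<and> y i} = s" using assms(1) by (simp add: balanced_def)
    ultimately show ?thesis by linarith
  qed
  have fibre: "{\<phi> \<in> labellings n s. sub n \<phi> y = x} = PiE {..<n} (\<lambda>j. {i. i < s \<and> y i = x j})"
    if x: "x \<in> cube n" for x
  proof (intro equalityI subsetI)
    fix \<phi> assume "\<phi> \<in> {\<phi> \<in> labellings n s. sub n \<phi> y = x}"
    then show "\<phi> \<in> PiE {..<n} (\<lambda>j. {i. i < s \<and> y i = x j})"
      by (auto simp: labellings_def PiE_def Pi_def sub_def)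
  next
    fix \<phi> assume \<phi>: "\<phi> \<in> PiE {..<n} (\<lambda>j. {i. i < s \<and> y i = x j})"
    have "sub n \<phi> y = sub n id x" using \<phi> by (intro sub_cong) auto
    then show "\<phi> \<in> {\<phi> \<in> labellings n s. sub n \<phi> y = x}"
      using \<phi> x by (auto simp: labellings_def PiE_def Pi_def)
  qed
  have card: "card {\<phi> \<in> labellings n s. sub n \<phi> y = x} = (s div 2) ^ n" if "x \<in> cube n" for x
    unfolding fibre[OF that] by (simp add: card_PiE half)
  have "2 * card {i. i < s \<and> y i} = s" using assms(1) by (simp add: balanced_def)
  then have pos: "0 < s div 2" using assms(2) by presburger
  have "(\<lambda>\<phi>. sub n \<phi> y) ` labellings n s = cube n"
  proof (intro equalityI subsetI)
    fix x assume "x \<in> cube n"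
    then have "card {\<phi> \<in> labellings n s. sub n \<phi> y = x} \<noteq> 0" using pos by (simp only: card) simp
    then have "{\<phi> \<in> labellings n s. sub n \<phi> y = x} \<noteq> {}" by force
    then show "x \<in> (\<lambda>\<phi>. sub n \<phi> y) ` labellings n s" by auto
  qed auto
  then show ?thesis using assms(2) labellings_nonempty
    by (intro map_pmf_of_set_equal_fibres[where c="(s div 2) ^ n"] card) auto
qed

lemma labellings_avg_balanced:
  assumes "y \<in> balanced s" "0 < s"
  shows "measure_pmf.expectation (pmf_of_set (labellings n s)) (\<lambda>\<phi>. q (sub n \<phi> y)) = cube_avg n q"
proof -
  have "cube_avg n q = measure_pmf.expectation (map_pmf (\<lambda>\<phi>. sub n \<phi> y) (pmf_of_set (labellings n s))) q"
    by (simp only: map_pmf_balanced[OF assms] cube_avg_def)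
  also have "\<dots> = measure_pmf.expectation (pmf_of_set (labellings n s)) (\<lambda>\<phi>. q (sub n \<phi> y))"
    by (rule integral_map_pmf)
  finally show ?thesis ..
qed

section \<open>Resampling and approximation by juntas\<close>

lemma sum_squares_le2: "((a::real) - c)\<^sup>2 \<le> 2 * (a - b)\<^sup>2 + 2 * (b - c)\<^sup>2"
  using sum_squares_bound[of "a - b" "b - c"]
  by (simp add: power2_eq_square algebra_simps)

lemma sum_squares_le3: "((a::real) - d)\<^sup>2 \<le> 3 * (a - b)\<^sup>2 + 3 * (b - c)\<^sup>2 + 3 * (c - d)\<^sup>2"
proof -
  have "0 \<le> ((a-b)-(b-c))\<^sup>2 + ((b-c)-(c-d))\<^sup>2 + ((a-b)-(c-d))\<^sup>2" by simp
  then show ?thesis by (simp add: power2_eq_square algebra_simps)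
qed

lemma mix_range: "mix n S ` {..<n} \<subseteq> {..<2 * n}"
  by (auto simp: mix_def)

text \<open>Resampling off \<open>S\<close> and then off \<open>T\<close> amounts to resampling off \<open>S \<inter> T\<close>.\<close>

lemma dev_Int:
  "dev n f (S \<inter> T) \<le> 2 * dev n f S + 2 * dev n f T"
proof -
  \<comment> \<open>The three blocks of \<open>cube (3 * n)\<close> hold independent points.
    \<open>?a\<close> is the first, \<open>?b\<close> replaces it off \<open>S\<close> by the
    second, and \<open>?c\<close> replaces \<open>?b\<close> off \<open>T\<close> by the
    third.\<close>
  define \<iota> where "\<iota> j = (if j \<in> S \<and> j \<in> T then j else if j \<in> T then n + j else 2 * n + j)" for j
  let ?a = "\<lambda>w. f (sub n id w)" and ?b = "\<lambda>w. f (sub n (mix n S) w)" and ?c = "\<lambda>w. f (sub n \<iota> w)"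
  let ?avg = "cube_avg (3 * n)"
  have ac: "?avg (\<lambda>w. (?a w - ?c w)\<^sup>2) = dev n f (S \<inter> T)"
  proof -
    \<comment> \<open>Off \<open>S \<inter> T\<close> the point \<open>?c\<close> reads a fresh bit,
      from the second block on \<open>T - S\<close> and from the third one off \<open>T\<close>. The
      renaming \<open>\<kappa>\<close> selects the right block for each coordinate.\<close>
    define \<kappa> where "\<kappa> i = (if i < n then i else if i - n \<in> T - S then i else i + n)" for i
    have \<kappa>: "inj_on \<kappa> {..<2 * n}" "\<kappa> ` {..<2 * n} \<subseteq> {..<3 * n}"
      by (auto simp: inj_on_def \<kappa>_def split: if_splits)
    have 1: "sub n id (sub (2 * n) \<kappa> w) = sub n id w" for w
      by (subst sub_sub) (auto intro!: sub_cong simp: \<kappa>_def)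
    have 2: "sub n (mix n (S \<inter> T)) (sub (2 * n) \<kappa> w) = sub n \<iota> w" for w
      by (subst sub_sub) (auto intro!: sub_cong arg_cong[where f=w] simp: \<kappa>_def \<iota>_def mix_def)
    show ?thesis
      unfolding dev_def by (subst cube_avg_sub[OF \<kappa>, symmetric]) (simp add: 1 2)
  qed
  have ab: "?avg (\<lambda>w. (?a w - ?b w)\<^sup>2) = dev n f S"
  proof -
    have \<kappa>: "inj_on id {..<2 * n}" "id ` {..<2 * n} \<subseteq> {..<3 * n}" by auto
    have 1: "sub n id (sub (2 * n) id w) = sub n id w" for w
      by (subst sub_sub) auto
    have 2: "sub n (mix n S) (sub (2 * n) id w) = sub n (mix n S) w" for w
      by (subst sub_sub) (auto simp: mix_def)
    show ?thesis
      unfolding dev_def by (subst cube_avg_sub[OF \<kappa>, symmetric]) (simp add: 1 2)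
  qed
  have bc: "?avg (\<lambda>w. (?b w - ?c w)\<^sup>2) = dev n f T"
  proof -
    \<comment> \<open>The already resampled point \<open>?b\<close> is itself uniform and
      independent of the third block, so it can take the role of the original point.\<close>
    define \<kappa> where "\<kappa> i = (if i < n then mix n S i else i + n)" for i
    have \<kappa>: "inj_on \<kappa> {..<2 * n}" "\<kappa> ` {..<2 * n} \<subseteq> {..<3 * n}"
      by (auto simp: inj_on_def \<kappa>_def mix_def split: if_splits)
    have 1: "sub n id (sub (2 * n) \<kappa> w) = sub n (mix n S) w" for w
      by (subst sub_sub) (auto intro!: sub_cong simp: \<kappa>_def)
    have 2: "sub n (mix n T) (sub (2 * n) \<kappa> w) = sub n \<iota> w" for w
      by (subst sub_sub) (auto intro!: sub_cong arg_cong[where f=w] simp: \<kappa>_def \<iota>_def mix_def)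
    show ?thesis
      unfolding dev_def by (subst cube_avg_sub[OF \<kappa>, symmetric]) (simp add: 1 2)
  qed
  have "?avg (\<lambda>w. (?a w - ?c w)\<^sup>2) \<le> ?avg (\<lambda>w. 2 * (?a w - ?b w)\<^sup>2 + 2 * (?b w - ?c w)\<^sup>2)"
    by (intro cube_avg_mono sum_squares_le2)
  then show ?thesis by (simp add: cube_avg_add cube_avg_cmult ac ab bc)
qed

text \<open>The junta takes the same value before and after resampling, so the change of
  \<open>f\<close> is controlled by its errors at the two ends. Each end is uniform, which gives 2 +
  2 = 4.\<close>

lemma dev_junta_le:
  assumes "depends_on n J h" "J \<subseteq> S" "J \<subseteq> {..<n}"
  shows "dev n f S \<le> 4 * cube_avg n (\<lambda>x. (f x - h x)\<^sup>2)"
proof -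
  let ?r = "\<lambda>x. (f x - h x)\<^sup>2"
  have eq: "h (sub n id w) = h (sub n (mix n S) w)" for w
  proof -
    have "sub n id w i = sub n (mix n S) w i" if "i \<in> J" for i
    proof -
      have "i < n" "i \<in> S" using that assms(2,3) by auto
      then show ?thesis by (simp add: sub_apply mix_def)
    qed
    then show ?thesis using assms(1) unfolding depends_on_def by simp
  qed
  have mono: "inj_on (mix n S) {..<n}" by (auto simp: inj_on_def mix_def split: if_splits)
  have "dev n f S \<le> cube_avg (2 * n) (\<lambda>w. 2 * ?r (sub n id w) + 2 * ?r (sub n (mix n S) w))"
    unfolding dev_def
  proof (rule cube_avg_mono)
    fix w
    show "(f (sub n id w) - f (sub n (mix n S) w))\<^sup>2 \<le> 2 * ?r (sub n id w) + 2 * ?r (sub n (mix n S) w)"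
      using sum_squares_le2[of "f (sub n id w)" "f (sub n (mix n S) w)" "h (sub n id w)"]
      by (simp add: eq power2_commute)
  qed
  also have "\<dots> = 4 * cube_avg n ?r"
    using cube_avg_sub[OF mono mix_range, of ?r] cube_avg_sub[of id n "2*n" ?r]
    by (simp add: cube_avg_add cube_avg_cmult)
  finally show ?thesis .
qed

text \<open>Freezing the coordinates off \<open>S\<close> at a string \<open>z\<close> turns
  \<open>f\<close> into a junta on \<open>S\<close>. The squared error averaged over
  \<open>z\<close> is exactly \<open>dev n f S\<close>, so some \<open>z\<close> does at least as
  well and no constant is lost.\<close>

lemma dev_junta_exists:
  assumes f: "f \<in> bfuns n"
  shows "\<exists>h\<in>bfuns n. depends_on n S h \<and> cube_avg n (\<lambda>x. (f x - h x)\<^sup>2) \<le> dev n f S"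
proof -
  define join where "join = (\<lambda>(x, z). \<lambda>i\<in>{..<2 * n}. if i < n then x i else z (i - n) :: bool)"
  define h where "h z = (\<lambda>x\<in>cube n. f (\<lambda>j\<in>{..<n}. if j \<in> S then x j else z j))" for z :: point
  let ?v = "\<lambda>z. cube_avg n (\<lambda>x. (f x - h z x)\<^sup>2)"
  have jc: "join p \<in> cube (2 * n)" for p
    by (cases p) (simp add: join_def cube_def)
  have bij: "bij_betw join (cube n \<times> cube n) (cube (2 * n))"
  proof (rule bij_betw_byWitness[where f'="\<lambda>w. (sub n id w, sub n (\<lambda>j. n + j) w)"])
    show "\<forall>p\<in>cube n \<times> cube n. (sub n id (join p), sub n (\<lambda>j. n + j) (join p)) = p"
    proof
      fix p assume "p \<in> cube n \<times> cube n"
      then obtain x z where xz: "x \<in> cube n" "z \<in> cube n" and p: "p = (x, z)" by auto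
      have "sub n id (join (x, z)) = sub n id x" "sub n (\<lambda>j. n + j) (join (x, z)) = sub n id z"
        by (auto intro!: sub_cong simp: join_def)
      then show "(sub n id (join p), sub n (\<lambda>j. n + j) (join p)) = p"
        using xz p by simp
    qed
    show "\<forall>w\<in>cube (2 * n). join (sub n id w, sub n (\<lambda>j. n + j) w) = w"
    proof
      fix w assume w: "w \<in> cube (2 * n)"
      have "join (sub n id w, sub n (\<lambda>j. n + j) w) = sub (2 * n) id w"
        by (auto simp: join_def sub_def fun_eq_iff restrict_def)
      then show "join (sub n id w, sub n (\<lambda>j. n + j) w) = w" using w by simp
    qed
  qed (use jc in auto)
  have hz: "f (sub n (mix n S) (join (x, z))) = h z x" if "x \<in> cube n" for x z
  proof -
    have "sub n (mix n S) (join (x, z)) = (\<lambda>j\<in>{..<n}. if j \<in> S then x j else z j)"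
      by (simp add: sub_def join_def mix_def fun_eq_iff)
    then show ?thesis using that by (simp add: h_def)
  qed
  have xz: "sub n id (join (x, z)) = x" if "x \<in> cube n" for x z
  proof -
    have "sub n id (join (x, z)) = sub n id x" by (auto intro!: sub_cong simp: join_def)
    then show ?thesis using that by simp
  qed
  have "dev n f S = (\<Sum>p\<in>cube n \<times> cube n. (f (sub n id (join p)) - f (sub n (mix n S) (join p)))\<^sup>2) / 2 ^ (2 * n)"
    unfolding dev_def cube_avg_sum by (subst sum.reindex_bij_betw[OF bij, symmetric]) simp
  also have "\<dots> = (\<Sum>(x,z)\<in>cube n \<times> cube n. (f x - h z x)\<^sup>2) / 2 ^ (2 * n)"
    by (intro arg_cong2[where f="(/)"] sum.cong refl) (auto simp: xz hz)
  also have "\<dots> = (\<Sum>z\<in>cube n. \<Sum>x\<in>cube n. (f x - h z x)\<^sup>2) / 2 ^ (2 * n)"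
    by (subst sum.cartesian_product[symmetric], subst sum.swap) simp
  also have "\<dots> = cube_avg n ?v"
    by (simp add: cube_avg_sum sum_divide_distrib[symmetric] mult_2 power_add)
  finally have D: "dev n f S = cube_avg n ?v" .
  have "\<exists>z\<in>cube n. ?v z \<le> dev n f S"
  proof (rule ccontr)
    assume "\<not> ?thesis"
    then have "(\<Sum>z\<in>cube n. dev n f S) < (\<Sum>z\<in>cube n. ?v z)"
      by (intro sum_strict_mono) auto
    then show False using D by (simp add: cube_avg_sum[of n ?v] card_cube field_simps)
  qed
  then obtain z where z: "z \<in> cube n" "?v z \<le> dev n f S" by blast
  have "h z \<in> bfuns n"
    using f by (auto simp: bfuns_def h_def cube_def PiE_def Pi_def)
  moreover have "depends_on n S (h z)"
    unfolding depends_on_def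
  proof (intro ballI impI)
    fix x y assume xy: "x \<in> cube n" "y \<in> cube n" "\<forall>i\<in>S. x i = y i"
    then have "(\<lambda>j\<in>{..<n}. if j \<in> S then x j else z j) = (\<lambda>j\<in>{..<n}. if j \<in> S then y j else z j)"
      by (simp add: fun_eq_iff)
    then show "h z x = h z y" using xy by (simp add: h_def)
  qed
  ultimately show ?thesis using z by blast
qed

subsection \<open>Random partitions\<close>

definition preim :: "nat \<Rightarrow> (nat \<Rightarrow> nat) \<Rightarrow> nat set \<Rightarrow> nat set" where
  "preim n \<phi> A = {j. j < n \<and> \<phi> j \<in> A}"

lemma preim_subset: "preim n \<phi> A \<subseteq> {..<n}"
  by (auto simp: preim_def)

lemma prob_labellings:
  assumes "0 < s"
  shows "measure_pmf.prob (pmf_of_set (labellings n s)) {\<phi>. Q \<phi>}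
    = real (card {\<phi> \<in> labellings n s. Q \<phi>}) / real s ^ n"
  using labellings_nonempty[OF assms]
  by (simp add: measure_pmf_of_set card_labellings Int_def)

lemma card_preim_fibre:
  assumes "B \<subseteq> {..<s}" "S \<subseteq> {..<n}"
  shows "card {\<phi> \<in> labellings n s. preim n \<phi> B = S} = card B ^ card S * (s - card B) ^ (n - card S)"
proof -
  have fB: "finite B" using assms(1) finite_subset by blast
  have "{\<phi> \<in> labellings n s. preim n \<phi> B = S} = PiE {..<n} (\<lambda>j. if j \<in> S then B else {..<s} - B)"
  proof (intro equalityI subsetI)
    fix \<phi> assume "\<phi> \<in> {\<phi> \<in> labellings n s. preim n \<phi> B = S}"
    then have \<phi>: "\<phi> \<in> {..<n} \<rightarrow>\<^sub>E {..<s}" and S: "S = {j. j < n \<and> \<phi> j \<in> B}"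
      by (simp_all add: labellings_def preim_def)
    show "\<phi> \<in> PiE {..<n} (\<lambda>j. if j \<in> S then B else {..<s} - B)"
    proof (rule PiE_I)
      fix j assume "j \<in> {..<n}"
      then show "\<phi> j \<in> (if j \<in> S then B else {..<s} - B)" using PiE_mem[OF \<phi>] S by simp
    qed (use PiE_arb[OF \<phi>] in simp)
  next
    fix \<phi> assume \<phi>: "\<phi> \<in> PiE {..<n} (\<lambda>j. if j \<in> S then B else {..<s} - B)"
    have m: "\<phi> j \<in> (if j \<in> S then B else {..<s} - B)" if "j < n" for j
      using PiE_mem[OF \<phi>, of j] that by simp
    have "\<phi> j < s" if "j < n" for j using m[OF that] assms(1) by (auto split: if_splits)
    then have "\<phi> \<in> labellings n s" using \<phi> by (auto simp: labellings_def PiE_def)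
    moreover have "preim n \<phi> B = S" using m assms(2) by (force simp: preim_def split: if_splits)
    ultimately show "\<phi> \<in> {\<phi> \<in> labellings n s. preim n \<phi> B = S}" by simp
  qed
  then have "card {\<phi> \<in> labellings n s. preim n \<phi> B = S} = (\<Prod>j<n. if j \<in> S then card B else s - card B)"
    using fB assms(1) by (simp add: card_PiE card_Diff_subset if_distrib[of card] cong: if_cong)
  also have "\<dots> = card B ^ card ({..<n} \<inter> S) * (s - card B) ^ card ({..<n} \<inter> - S)"
    by (simp add: prod.If_cases)
  also have "{..<n} \<inter> S = S" using assms(2) by auto
  also have "{..<n} \<inter> - S = {..<n} - S" by auto
  also have "card ({..<n} - S) = n - card S"
    using assms(2) finite_subset by (subst card_Diff_subset) auto
  finally show ?thesis .
qed

lemma prob_preim_biased: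
  assumes "B \<subseteq> {..<s}" "0 < s"
  shows "measure_pmf.prob (pmf_of_set (labellings n s)) {\<phi>. F (preim n \<phi> B)}
    = biased (real (card B) / real s) n F"
proof -
  let ?F = "{S. S \<subseteq> {..<n} \<and> F S}" and ?b = "card B"
  have bs: "?b \<le> s" using card_mono[OF _ assms(1)] by simp
  have "{\<phi> \<in> labellings n s. F (preim n \<phi> B)} = (\<Union>S\<in>?F. {\<phi> \<in> labellings n s. preim n \<phi> B = S})"
    using preim_subset by auto
  then have "card {\<phi> \<in> labellings n s. F (preim n \<phi> B)} = (\<Sum>S\<in>?F. card {\<phi> \<in> labellings n s. preim n \<phi> B = S})"
    by (simp only:) (rule card_UN_disjoint, auto)
  also have "\<dots> = (\<Sum>S\<in>?F. ?b ^ card S * (s - ?b) ^ (n - card S))"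
    by (intro sum.cong refl card_preim_fibre assms) auto
  finally have "real (card {\<phi> \<in> labellings n s. F (preim n \<phi> B)}) / real s ^ n
     = (\<Sum>S\<in>?F. real ?b ^ card S * (real s - real ?b) ^ (n - card S) / real s ^ n)"
    using bs by (simp add: of_nat_diff sum_divide_distrib)
  also have "\<dots> = biased (real ?b / real s) n F"
    unfolding biased_def
  proof (intro sum.cong refl)
    fix S assume "S \<in> ?F"
    then have "card S \<le> n" using card_mono[of "{..<n}" S] by simp
    then have "real s ^ n = real s ^ card S * real s ^ (n - card S)"
      by (simp add: power_add[symmetric])
    moreover have "1 - real ?b / real s = (real s - real ?b) / real s"
      using assms(2) by (simp add: diff_divide_distrib)
    ultimately show "real ?b ^ card S * (real s - real ?b) ^ (n - card S) / real s ^ n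
        = (real ?b / real s) ^ card S * (1 - real ?b / real s) ^ (n - card S)"
      by (simp add: power_divide)
  qed
  finally show ?thesis by (simp add: prob_labellings[OF assms(2)])
qed

text \<open>A union of \<open>k\<close> random parts is too correlated with the choice of the parts for a union bound.
  Instead every such union is contained in \<open>binomial (s - k) (b - k)\<close> unions of \<open>b\<close> parts, and a union of \<open>b\<close>
  fixed parts is a \<open>b / s\<close>-biased random set.\<close>

lemma prob_union_of_parts:
  assumes "k \<le> b" "2 * b \<le> s" "0 < b"
    and up: "\<And>S T. F S \<Longrightarrow> S \<subseteq> T \<Longrightarrow> T \<subseteq> {..<n} \<Longrightarrow> F T"
    and int: "\<And>S T. S \<subseteq> {..<n} \<Longrightarrow> T \<subseteq> {..<n} \<Longrightarrow> F S \<Longrightarrow> F T \<Longrightarrow> t \<le> card (S \<inter> T)"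
  shows "measure_pmf.prob (pmf_of_set (labellings n s))
      {\<phi>. \<exists>A\<subseteq>{..<s}. card A = k \<and> F (preim n \<phi> A)} * real (b choose k)
    \<le> real (s choose k) * (real b / real (s - b)) ^ t"
proof -
  let ?L = "labellings n s"
  define \<B> where "\<B> = {B. B \<subseteq> {..<s} \<and> card B = b}"
  define \<Phi> where "\<Phi> = {\<phi> \<in> ?L. \<exists>A\<subseteq>{..<s}. card A = k \<and> F (preim n \<phi> A)}"
  have s: "0 < s" using assms by linarith
  have fB: "finite \<B>" unfolding \<B>_def by simp
  have fP: "finite \<Phi>" unfolding \<Phi>_def by simp
  have cB: "card \<B> = s choose b" unfolding \<B>_def by (simp add: n_subsets)
  have lower: "(s - k) choose (b - k) \<le> card {B \<in> \<B>. F (preim n \<phi> B)}" if "\<phi> \<in> \<Phi>" for \<phi>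
  proof -
    from that obtain A where A: "A \<subseteq> {..<s}" "card A = k" "F (preim n \<phi> A)" by (auto simp: \<Phi>_def)
    have fA: "finite A" using A(1) finite_subset by blast
    let ?C = "{C. C \<subseteq> {..<s} - A \<and> card C = b - k}"
    have c1: "card ?C = (s - k) choose (b - k)"
      using A fA by (simp add: n_subsets card_Diff_subset)
    have c2: "inj_on ((\<union>) A) ?C" by (auto simp: inj_on_def)
    have c3: "(\<union>) A ` ?C \<subseteq> {B \<in> \<B>. F (preim n \<phi> B)}"
    proof safe
      fix C assume C: "C \<subseteq> {..<s} - A" "card C = b - k"
      have "finite C" using C(1) finite_subset by blast
      then have "card (A \<union> C) = b" using A(2) C fA assms(1) by (subst card_Un_disjoint) auto
      then show "A \<union> C \<in> \<B>" using A(1) C(1) by (auto simp: \<B>_def)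
      show "F (preim n \<phi> (A \<union> C))"
        by (rule up[OF A(3)]) (auto simp: preim_def)
    qed
    have "finite {B \<in> \<B>. F (preim n \<phi> B)}" using fB by simp
    from card_inj_on_le[OF c2 c3 this] show ?thesis by (simp only: c1)
  qed
  have nat: "card \<Phi> * ((s - k) choose (b - k)) \<le> (\<Sum>\<phi>\<in>\<Phi>. card {B \<in> \<B>. F (preim n \<phi> B)})"
    using sum_bounded_below[of \<Phi> "(s - k) choose (b - k)" "\<lambda>\<phi>. card {B \<in> \<B>. F (preim n \<phi> B)}"] lower
    by simp
  have "real (card \<Phi>) * real ((s - k) choose (b - k)) = real (card \<Phi> * ((s - k) choose (b - k)))" by simp
  also have "\<dots> \<le> real (\<Sum>\<phi>\<in>\<Phi>. card {B \<in> \<B>. F (preim n \<phi> B)})"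
    unfolding of_nat_le_iff by (rule nat)
  also have "\<dots> \<le> real (\<Sum>\<phi>\<in>?L. card {B \<in> \<B>. F (preim n \<phi> B)})"
    unfolding of_nat_le_iff by (rule sum_mono2) (auto simp: \<Phi>_def)
  also have "(\<Sum>\<phi>\<in>?L. card {B \<in> \<B>. F (preim n \<phi> B)}) = (\<Sum>B\<in>\<B>. card {\<phi> \<in> ?L. F (preim n \<phi> B)})"
    by (simp only: card_eq_sum sum.inter_filter[OF fB] sum.inter_filter[OF finite_labellings]) (rule sum.swap)
  also have "real \<dots> = (\<Sum>B\<in>\<B>. real s ^ n * biased (real b / real s) n F)"
    unfolding of_nat_sum
  proof (intro sum.cong refl)
    fix B assume "B \<in> \<B>"
    then have B: "B \<subseteq> {..<s}" "card B = b" by (auto simp: \<B>_def)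
    from prob_preim_biased[OF B(1) s, of n F] show "real (card {\<phi> \<in> ?L. F (preim n \<phi> B)}) = real s ^ n * biased (real b / real s) n F"
      using s by (simp add: prob_labellings B(2) field_simps)
  qed
  also have "\<dots> = real s ^ n * (real (s choose b) * biased (real b / real s) n F)" by (simp add: cB)
  also have "\<dots> \<le> real s ^ n * (real (s choose b) * (real b / real (s - b)) ^ t)"
  proof -
    have "biased (real b / real s) n F \<le> ((real b / real s) / (1 - real b / real s)) ^ t"
      using assms s int by (intro intersecting_biased) (auto simp: field_simps simp flip: of_nat_mult)
    also have "(real b / real s) / (1 - real b / real s) = real b / real (s - b)"
      using assms s by (simp add: field_simps of_nat_diff)
    finally show ?thesis by (intro mult_left_mono) auto
  qed
  finally have main: "real (card \<Phi>) / real s ^ n * real ((s - k) choose (b - k)) \<le> real (s choose b) * (real b / real (s - b)) ^ t"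
    using s by (simp add: field_simps)
  let ?p = "real (card \<Phi>) / real s ^ n"
  have pos: "0 < real ((s - k) choose (b - k))" using assms by simp
  \<comment> \<open>Both sides count pairs of a \<open>b\<close>-set and a \<open>k\<close>-subset
    of it. This trades the ratio of \<open>s choose b\<close> to
    \<open>(s - k) choose (b - k)\<close> for the ratio of \<open>s choose k\<close> to
    \<open>b choose k\<close>.\<close>
  have id: "real (s choose b) * real (b choose k) = real (s choose k) * real ((s - k) choose (b - k))"
    using choose_mult[of k b s] assms by (simp flip: of_nat_mult)
  have "?p * real (b choose k) * real ((s - k) choose (b - k))
      \<le> real (s choose b) * (real b / real (s - b)) ^ t * real (b choose k)"
    using mult_right_mono[OF main, of "real (b choose k)"] by (simp add: mult_ac)
  also have "\<dots> = (real (s choose k) * (real b / real (s - b)) ^ t) * real ((s - k) choose (b - k))"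
    using arg_cong[OF id, of "\<lambda>x. x * (real b / real (s - b)) ^ t"] by (simp add: mult_ac)
  finally have "?p * real (b choose k) \<le> real (s choose k) * (real b / real (s - b)) ^ t"
    using pos by (simp only: mult_le_cancel_right)
  then show ?thesis by (simp add: prob_labellings[OF s] \<Phi>_def)
qed

text \<open>The value is 100 k times b for the auxiliary size b = 4 k^2 of
  \<open>prob_union_of_parts_small\<close>. The first factor keeps b / s small, and b of order k^2
  keeps (1 - k / b)^k bounded below. The number is even, as balanced strings require, and exceeds
  k^2 enough to make collisions of k variables rare.\<close>

definition parts :: "nat \<Rightarrow> nat" where
  "parts k = 400 * k ^ 3"

lemma choose_ratio_le:
  assumes "k < b" "b \<le> s"
  shows "real (s choose k) \<le> (real s / real (b - k)) ^ k * real (b choose k)"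
proof -
  have "real (s choose k) = (\<Prod>i<k. real (s - i) / real (k - i))"
    using assms by (simp add: binomial_altdef_of_nat lessThan_atLeast0)
  also have "\<dots> \<le> (\<Prod>i<k. (real s / real (b - k)) * (real (b - i) / real (k - i)))"
  proof (intro prod_mono conjI)
    fix i assume i: "i \<in> {..<k}"
    have "real (s - i) * real (b - k) \<le> real s * real (b - i)"
      using i assms by (intro mult_mono) auto
    then have "real (s - i) \<le> real s / real (b - k) * real (b - i)"
      using assms by (simp add: field_simps)
    then show "real (s - i) / real (k - i) \<le> real s / real (b - k) * (real (b - i) / real (k - i))"
      using divide_right_mono[of _ _ "real (k - i)"] by fastforce
  qed auto
  also have "\<dots> = (real s / real (b - k)) ^ k * (\<Prod>i<k. real (b - i) / real (k - i))"
    by (simp only: prod.distrib prod_constant card_lessThan)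
  also have "(\<Prod>i<k. real (b - i) / real (k - i)) = real (b choose k)"
    using assms by (simp add: binomial_altdef_of_nat lessThan_atLeast0)
  finally show ?thesis .
qed

text \<open>Up to lower order corrections the ratio of \<open>s choose k\<close> to
  \<open>b choose k\<close> is (s / b)^k. It cancels \<open>k\<close> of the \<open>Suc k\<close>
  factors in the measure bound, and the remaining factor, at most 1/99, provides the
  smallness.\<close>

lemma prob_union_of_parts_small:
  assumes k: "1 \<le> k"
    and up: "\<And>S T. F S \<Longrightarrow> S \<subseteq> T \<Longrightarrow> T \<subseteq> {..<n} \<Longrightarrow> F T"
    and int: "\<And>S T. S \<subseteq> {..<n} \<Longrightarrow> T \<subseteq> {..<n} \<Longrightarrow> F S \<Longrightarrow> F T \<Longrightarrow> Suc k \<le> card (S \<inter> T)"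
  shows "measure_pmf.prob (pmf_of_set (labellings n (parts k)))
      {\<phi>. \<exists>A\<subseteq>{..<parts k}. card A = k \<and> F (preim n \<phi> A)} \<le> 1 / 20" (is "?p \<le> _")
proof -
  define b s where "b = 4 * k\<^sup>2" and "s = parts k"
  have kk: "k \<le> k * k" using k by simp
  have kkk: "k * k \<le> k * k * k" using k by simp
  have b: "k < b" "2 * b \<le> s" "0 < b"
    using k kk kkk by (auto simp: b_def s_def parts_def power2_eq_square power3_eq_cube) 
  have s: "0 < s" using b by linarith
  have rs: "real s = 100 * real k * real b" by (simp add: s_def b_def parts_def power2_eq_square power3_eq_cube)
  have rb: "real b = 4 * real k * real k" by (simp add: b_def power2_eq_square)
  have rk: "1 \<le> real k" using k by simp
  \<comment> \<open>\<open>X\<close> pairs one factor of the binomial ratio with one factor of the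
    measure bound. The main terms cancel, so \<open>X\<close> exceeds 1 only by relative order 1 / k
    and its \<open>k\<close>-th power stays bounded.\<close>
  define X where "X = real s / real (b - k) * (real b / real (s - b))"
  have rbk: "real (b - k) = real b * (1 - 1 / (4 * real k))"
    using b k by (simp add: of_nat_diff rb field_simps)
  have rsb: "real (s - b) = real s * (1 - 1 / (100 * real k))"
    using b k by (simp add: of_nat_diff rs field_simps)
  have X: "X * ((1 - 1 / (4 * real k)) * (1 - 1 / (100 * real k))) = 1"
  proof -
    have "0 < 1 - 1 / (4 * real k)" "0 < 1 - 1 / (100 * real k)" using rk by simp_all
    then have "real (b - k) \<noteq> 0" "real (s - b) \<noteq> 0" using b by simp_all
    then have "X * (real (b - k) * real (s - b)) = real s * real b" by (simp add: X_def)
    then have "X * ((1 - 1 / (4 * real k)) * (1 - 1 / (100 * real k))) * (real s * real b) = 1 * (real s * real b)"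
      unfolding rbk rsb by (simp only: mult_ac)
    then show ?thesis using b s by (simp only: mult_cancel_right) auto
  qed
  have Xp: "0 < X" unfolding X_def using b by simp
  \<comment> \<open>Used with c = 4 and c = 100, for the bounds 3/4 and 99/100.\<close>
  have bern: "1 - 1 / c \<le> (1 - 1 / (c * real k)) ^ k" if "1 \<le> c" for c :: real
  proof -
    have "1 + real k * (- (1 / (c * real k))) \<le> (1 + (- (1 / (c * real k)))) ^ k"
      using that rk mult_mono[of 1 c 1 "real k"] by (intro Bernoulli_inequality) (auto simp: field_simps)
    then show ?thesis using rk by simp
  qed
  have "(3 / 4) * (99 / 100) \<le> ((1 - 1 / (4 * real k)) ^ k) * ((1 - 1 / (100 * real k)) ^ k)"
    using bern[of 4] bern[of 100] by (intro mult_mono) auto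
  then have "X ^ k * ((3 / 4) * (99 / 100)) \<le> (X * ((1 - 1 / (4 * real k)) * (1 - 1 / (100 * real k)))) ^ k"
    using Xp by (simp add: power_mult_distrib mult_left_mono)
  then have Xk: "X ^ k * (297 / 400) \<le> 1" unfolding X by simp
  have q: "real b / real (s - b) \<le> 1 / 99"
  proof -
    have "99 * real b \<le> real (s - b)" using b rk by (simp add: of_nat_diff rs)
    then show ?thesis using b by (simp add: field_simps)
  qed
  have "?p * real (b choose k) \<le> real (s choose k) * (real b / real (s - b)) ^ Suc k"
    unfolding s_def[symmetric] by (rule prob_union_of_parts) (use b up int in auto)
  also have "\<dots> \<le> ((real s / real (b - k)) ^ k * real (b choose k)) * (real b / real (s - b)) ^ Suc k"
    using b by (intro mult_right_mono choose_ratio_le) auto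
  also have "\<dots> = (X ^ k * (real b / real (s - b))) * real (b choose k)"
    unfolding X_def power_mult_distrib by (simp only: power_Suc mult_ac)
  finally have le: "?p * real (b choose k) \<le> (X ^ k * (real b / real (s - b))) * real (b choose k)" .
  have "0 < real (b choose k)" using b by simp
  with le have "?p \<le> X ^ k * (real b / real (s - b))" by (rule mult_right_le_imp_le)
  also have "\<dots> \<le> X ^ k * (1 / 99)"
    using q Xp by (intro mult_left_mono) auto
  also have "\<dots> \<le> 1 / 20" using Xk by simp
  finally show ?thesis .
qed

lemma prob_dev_small:
  assumes k: "1 \<le> k" and far: "\<And>J. J \<subseteq> {..<n} \<Longrightarrow> card J \<le> k \<Longrightarrow> 4 * \<theta> < dev n f J"
  shows "measure_pmf.prob (pmf_of_set (labellings n (parts k)))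
      {\<phi>. \<exists>A\<subseteq>{..<parts k}. card A = k \<and> dev n f (preim n \<phi> A) \<le> \<theta>} \<le> 1 / 20"
proof -
  \<comment> \<open>The upward closure of the sets with small \<open>dev\<close> supplies the
    monotonicity needed for enlarging a union of parts, so that monotonicity of \<open>dev\<close>
    itself need not be shown. Intersections are taken of the subsets that witness
    membership.\<close>
  define F where "F S \<longleftrightarrow> (\<exists>S'\<subseteq>S. dev n f S' \<le> \<theta>)" for S
  have "measure_pmf.prob (pmf_of_set (labellings n (parts k)))
      {\<phi>. \<exists>A\<subseteq>{..<parts k}. card A = k \<and> F (preim n \<phi> A)} \<le> 1 / 20"
  proof (rule prob_union_of_parts_small[OF k])
    show "F T" if "F S" "S \<subseteq> T" for S T using that unfolding F_def by blast
    show "Suc k \<le> card (S \<inter> T)" if ST: "S \<subseteq> {..<n}" "T \<subseteq> {..<n}" "F S" "F T" for S T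
    proof -
      obtain S' T' where "S' \<subseteq> S" "dev n f S' \<le> \<theta>" "T' \<subseteq> T" "dev n f T' \<le> \<theta>"
        using ST(3,4) unfolding F_def by blast
      moreover from this have "dev n f (S' \<inter> T') \<le> 4 * \<theta>"
        using dev_Int[of n f S' T'] by simp
      moreover have "S' \<inter> T' \<subseteq> {..<n}" using \<open>S' \<subseteq> S\<close> ST(1) by auto
      ultimately have "k < card (S' \<inter> T')" using far[of "S' \<inter> T'"] by fastforce
      also have "\<dots> \<le> card (S \<inter> T)"
        using \<open>S' \<subseteq> S\<close> \<open>T' \<subseteq> T\<close> finite_subset[OF ST(1)] by (intro card_mono) auto
      finally show ?thesis by simp
    qed
  qed
  moreover have "measure_pmf.prob (pmf_of_set (labellings n (parts k)))
      {\<phi>. \<exists>A\<subseteq>{..<parts k}. card A = k \<and> dev n f (preim n \<phi> A) \<le> \<theta>}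
    \<le> measure_pmf.prob (pmf_of_set (labellings n (parts k)))
      {\<phi>. \<exists>A\<subseteq>{..<parts k}. card A = k \<and> F (preim n \<phi> A)}"
    by (rule measure_pmf.finite_measure_mono) (auto simp: F_def)
  ultimately show ?thesis by linarith
qed

section \<open>Separating the relevant variables into distinct parts\<close>

lemma prob_collision:
  assumes "i < n" "j < n" "i \<noteq> j" "0 < s"
  shows "measure_pmf.prob (pmf_of_set (labellings n s)) {\<phi>. \<phi> i = \<phi> j} = 1 / real s"
proof -
  let ?P = "\<lambda>c. PiE {..<n} (\<lambda>l. if l \<in> {i, j} then {c} else {..<s})"
  have eq: "{\<phi> \<in> labellings n s. \<phi> i = \<phi> j} = (\<Union>c<s. ?P c)"
  proof (intro equalityI subsetI)
    fix \<phi> assume "\<phi> \<in> {\<phi> \<in> labellings n s. \<phi> i = \<phi> j}"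
    then have "\<phi> \<in> ?P (\<phi> i)" "\<phi> i < s" using assms by (auto simp: labellings_def PiE_def Pi_def)
    then show "\<phi> \<in> (\<Union>c<s. ?P c)" by blast
  next
    fix \<phi> assume "\<phi> \<in> (\<Union>c<s. ?P c)"
    then obtain c where c: "c < s" "\<phi> \<in> ?P c" by auto
    have m: "\<phi> l \<in> (if l \<in> {i, j} then {c} else {..<s})" if "l < n" for l
      using PiE_mem[OF c(2), of l] that by simp
    have "\<phi> i = c" "\<phi> j = c" using m[of i] m[of j] assms by auto
    moreover have "\<phi> l < s" if "l < n" for l using m[OF that] c(1) by (auto split: if_splits)
    ultimately show "\<phi> \<in> {\<phi> \<in> labellings n s. \<phi> i = \<phi> j}"
      using c(2) by (auto simp: labellings_def PiE_def)
  qed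
  have disj: "?P c \<inter> ?P d = {}" if "c \<noteq> d" for c d
  proof -
    have False if "\<phi> \<in> ?P c" "\<phi> \<in> ?P d" for \<phi>
      using PiE_mem[OF that(1), of i] PiE_mem[OF that(2), of i] assms(1) \<open>c \<noteq> d\<close> by simp
    then show ?thesis by blast
  qed
  have cP: "card (?P c) = s ^ (n - 2)" for c
  proof -
    have "card (?P c) = (\<Prod>l<n. if l \<in> {i, j} then 1 else s)"
      by (subst card_PiE) (auto intro!: prod.cong)
    also have "\<dots> = s ^ card ({..<n} \<inter> - {i, j})"
      by (simp only: prod.If_cases finite_lessThan Collect_mem_eq) simp
    also have "{..<n} \<inter> - {i, j} = {..<n} - {i, j}" by auto
    also have "card \<dots> = n - 2" using assms by (subst card_Diff_subset) auto
    finally show ?thesis .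
  qed
  have "card {\<phi> \<in> labellings n s. \<phi> i = \<phi> j} = (\<Sum>c<s. card (?P c))"
    unfolding eq
  proof (rule card_UN_disjoint)
    show "\<forall>c\<in>{..<s}. finite (?P c)" by (intro ballI finite_PiE) auto
    show "\<forall>c\<in>{..<s}. \<forall>d\<in>{..<s}. c \<noteq> d \<longrightarrow> ?P c \<inter> ?P d = {}" by (intro ballI impI disj)
  qed simp
  also have "\<dots> = s * s ^ (n - 2)" by (simp only: cP) simp
  finally have c: "card {\<phi> \<in> labellings n s. \<phi> i = \<phi> j} = s ^ (n - 1)"
    using assms by (cases n; cases "n - 1") auto
  have "real s ^ n = real s * real s ^ (n - 1)" using assms by (cases n) auto
  then show ?thesis using assms by (simp add: prob_labellings c)
qed

lemma prob_not_inj: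
  assumes "J \<subseteq> {..<n}" "card J \<le> k" "0 < s"
  shows "measure_pmf.prob (pmf_of_set (labellings n s)) {\<phi>. \<not> inj_on \<phi> J} \<le> (real k)\<^sup>2 / real s"
proof -
  let ?R = "measure_pmf (pmf_of_set (labellings n s))"
  have fJ: "finite J" using assms(1) finite_subset by blast
  define D where "D = {p \<in> J \<times> J. fst p \<noteq> snd p}"
  have fD: "finite D" using fJ by (auto simp: D_def)
  have "measure ?R {\<phi>. \<not> inj_on \<phi> J} \<le> measure ?R (\<Union>p\<in>D. {\<phi>. \<phi> (fst p) = \<phi> (snd p)})"
    by (rule measure_pmf.finite_measure_mono) (auto simp: inj_on_def D_def)
  also have "\<dots> \<le> (\<Sum>p\<in>D. measure ?R {\<phi>. \<phi> (fst p) = \<phi> (snd p)})"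
    using fD by (intro measure_pmf.finite_measure_subadditive_finite) auto
  also have "\<dots> = (\<Sum>p\<in>D. 1 / real s)"
    using assms by (intro sum.cong refl prob_collision) (auto simp: D_def)
  also have "\<dots> = real (card D) / real s" by simp
  also have "\<dots> \<le> (real k)\<^sup>2 / real s"
  proof -
    have "card D \<le> card (J \<times> J)" using fJ by (intro card_mono) (auto simp: D_def)
    also have "\<dots> \<le> k * k" using assms(2) by (simp add: card_cartesian_product mult_mono)
    finally have "real (card D) \<le> real (k * k)" by (rule of_nat_mono)
    then show ?thesis by (intro divide_right_mono) (auto simp: power2_eq_square)
  qed
  finally show ?thesis .
qed

lemma prob_not_inj_parts:
  assumes "J \<subseteq> {..<n}" "card J \<le> k" "1 \<le> k"
  shows "measure_pmf.prob (pmf_of_set (labellings n (parts k))) {\<phi>. \<not> inj_on \<phi> J} \<le> 1 / 20"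
proof -
  have "(real k)\<^sup>2 / real (parts k) = 1 / (400 * real k)"
    using assms(3) by (simp add: parts_def power2_eq_square power3_eq_cube)
  also have "\<dots> \<le> 1 / 20" using assms(3) by (simp add: field_simps)
  finally have "(real k)\<^sup>2 / real (parts k) \<le> 1 / 20" .
  moreover have "0 < parts k" using assms(3) by (simp add: parts_def)
  ultimately show ?thesis using prob_not_inj[OF assms(1,2)] order_trans by blast
qed

subsection \<open>Balanced designs and matching of juntas\<close>

text \<open>This bounds from below the share of balanced strings of length \<open>2 * h\<close> that
  extend a pattern of \<open>\<kappa>\<close> bits with \<open>a\<close> ones. Bits are fixed one at
  a time, and each leaves at least \<open>h - \<kappa>\<^sub>0\<close> out of at most
  \<open>2 * h\<close> positions of the right value. The separate \<open>\<kappa>\<^sub>0\<close>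
  keeps this bound constant through the induction.\<close>

lemma central_binomial_restrict:
  assumes "\<kappa> \<le> \<kappa>\<^sub>0" "\<kappa>\<^sub>0 \<le> h" "a \<le> \<kappa>"
  shows "((2 * h) choose h) * (h - \<kappa>\<^sub>0) ^ \<kappa> \<le> ((2 * h - \<kappa>) choose (h - a)) * (2 * h) ^ \<kappa>"
  using assms(1,3)
proof (induction \<kappa> arbitrary: a)
  case 0
  then show ?case by simp
next
  case (Suc \<kappa>)
  let ?N = "2 * h - \<kappa>"
  have N: "2 * h - Suc \<kappa> = ?N - 1" by simp
  \<comment> \<open>The bit split off is a zero, with \<open>a' = a\<close>, unless the pattern
    consists of ones only; then it is a one and \<open>a' = \<kappa>\<close>.\<close>
  have key: "\<exists>a'\<le>\<kappa>. (h - \<kappa>\<^sub>0) * (?N choose (h - a')) \<le> (2 * h) * ((?N - 1) choose (h - a))"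
  proof (cases "a \<le> \<kappa>")
    case True
    have "(h - \<kappa>\<^sub>0) * (?N choose (h - a)) \<le> (?N - (h - a)) * (?N choose (h - a))"
      using Suc.prems True assms(2) by (intro mult_right_mono) auto
    also have "\<dots> = ?N * ((?N - 1) choose (h - a))"
      by (rule binomial_absorb_comp)
    also have "\<dots> \<le> (2 * h) * ((?N - 1) choose (h - a))" by (intro mult_right_mono) auto
    finally show ?thesis using True by blast
  next
    case False
    then have a: "a = Suc \<kappa>" using Suc.prems by simp
    have "Suc (h - a) = h - \<kappa>" using a Suc.prems assms(2) by simp
    then have e: "(h - \<kappa>) * (?N choose (h - \<kappa>)) = ?N * ((?N - 1) choose (h - a))"
      using binomial_absorption[of "h - a" ?N] by simp
    have "(h - \<kappa>\<^sub>0) * (?N choose (h - \<kappa>)) \<le> (h - \<kappa>) * (?N choose (h - \<kappa>))"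
      using Suc.prems by (intro mult_right_mono) auto
    also have "\<dots> \<le> (2 * h) * ((?N - 1) choose (h - a))"
      unfolding e by (intro mult_right_mono) auto
    finally show ?thesis by blast
  qed
  then obtain a' where a': "a' \<le> \<kappa>"
    "(h - \<kappa>\<^sub>0) * (?N choose (h - a')) \<le> (2 * h) * ((?N - 1) choose (h - a))" by blast
  have "((2 * h) choose h) * (h - \<kappa>\<^sub>0) ^ Suc \<kappa> = (((2 * h) choose h) * (h - \<kappa>\<^sub>0) ^ \<kappa>) * (h - \<kappa>\<^sub>0)"
    by simp
  also have "\<dots> \<le> ((?N choose (h - a')) * (2 * h) ^ \<kappa>) * (h - \<kappa>\<^sub>0)"
    using Suc.IH[of a'] Suc.prems a' by (intro mult_right_mono) auto
  also have "\<dots> = ((h - \<kappa>\<^sub>0) * (?N choose (h - a'))) * (2 * h) ^ \<kappa>" by simp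
  also have "\<dots> \<le> ((2 * h) * ((?N - 1) choose (h - a))) * (2 * h) ^ \<kappa>"
    using a'(2) by (intro mult_right_mono) auto
  also have "\<dots> = ((2 * h - Suc \<kappa>) choose (h - a)) * (2 * h) ^ Suc \<kappa>" unfolding N by simp
  finally show ?case .
qed

lemma finite_balanced [simp]: "finite (balanced s)"
  by (simp add: balanced_def)

lemma card_balanced_le: "card (balanced (2 * h)) \<le> (2 * h) choose h"
proof -
  have "inj_on (\<lambda>y. {i. i < 2 * h \<and> y i}) (balanced (2 * h))"
  proof (rule inj_onI)
    fix y z assume yz: "y \<in> balanced (2 * h)" "z \<in> balanced (2 * h)"
      and eq: "{i. i < 2 * h \<and> y i} = {i. i < 2 * h \<and> z i}"
    have "sub (2 * h) id y = sub (2 * h) id z" using eq by (intro sub_cong) auto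
    then show "y = z" using yz by (simp add: balanced_def)
  qed
  then have "card (balanced (2 * h)) \<le> card {Y. Y \<subseteq> {..<2 * h} \<and> card Y = h}"
    by (rule card_inj_on_le) (auto simp: balanced_def)
  then show ?thesis by (simp add: n_subsets)
qed

definition indic :: "nat \<Rightarrow> nat set \<Rightarrow> point" where
  "indic s Y = (\<lambda>i\<in>{..<s}. i \<in> Y)"

lemma indic_balanced: "Y \<subseteq> {..<2 * h} \<Longrightarrow> card Y = h \<Longrightarrow> indic (2 * h) Y \<in> balanced (2 * h)"
proof -
  assume Y: "Y \<subseteq> {..<2 * h}" "card Y = h"
  then have "{i. i < 2 * h \<and> indic (2 * h) Y i} = Y" by (auto simp: indic_def)
  then show ?thesis using Y by (simp add: balanced_def indic_def cube_def)
qed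

lemma balanced_nonempty: "balanced (2 * h) \<noteq> {}"
  using indic_balanced[of "{..<h}" h] by auto

text \<open>The number \<open>a\<close> is the count of ones in \<open>v\<close>. A balanced
  extension is obtained by choosing the missing \<open>h - a\<close> ones outside the image of
  \<open>\<iota>\<close>.\<close>

lemma card_balanced_pattern:
  assumes \<iota>: "inj_on \<iota> {..<\<kappa>}" "\<iota> ` {..<\<kappa>} \<subseteq> {..<2 * h}" and "\<kappa> \<le> h" "v \<in> cube \<kappa>"
  obtains a where "a \<le> \<kappa>" "(2 * h - \<kappa>) choose (h - a) \<le> card {y \<in> balanced (2 * h). sub \<kappa> \<iota> y = v}"
proof -
  let ?K = "\<iota> ` {..<\<kappa>}" and ?U = "\<iota> ` {j. j < \<kappa> \<and> v j}"
  have inj_U: "inj_on \<iota> {j. j < \<kappa> \<and> v j}" by (rule inj_on_subset[OF \<iota>(1)]) auto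
  have "card ?U = card {j. j < \<kappa> \<and> v j}" using card_image[OF inj_U] .
  also have "\<dots> \<le> card {..<\<kappa>}" by (intro card_mono) auto
  finally have U: "card ?U \<le> \<kappa>" by simp
  let ?Z = "{Z. Z \<subseteq> {..<2 * h} - ?K \<and> card Z = h - card ?U}"
  have "card ?K = \<kappa>" using card_image[OF \<iota>(1)] by simp
  then have "card ({..<2 * h} - ?K) = 2 * h - \<kappa>" using \<iota>(2) by (subst card_Diff_subset) auto
  then have c1: "card ?Z = (2 * h - \<kappa>) choose (h - card ?U)" by (simp add: n_subsets)
  have UK: "?U \<subseteq> ?K" by auto
  have c2: "inj_on (\<lambda>Z. indic (2 * h) (?U \<union> Z)) ?Z"
  proof (rule inj_onI)
    fix Z Z' assume Z: "Z \<in> ?Z" "Z' \<in> ?Z" and eq: "indic (2 * h) (?U \<union> Z) = indic (2 * h) (?U \<union> Z')"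
    have "i \<in> ?U \<union> Z \<longleftrightarrow> i \<in> ?U \<union> Z'" if "i < 2 * h" for i
      using fun_cong[OF eq, of i] that by (simp add: indic_def)
    moreover have "Z \<subseteq> {..<2 * h} - ?K" "Z' \<subseteq> {..<2 * h} - ?K" using Z by auto
    ultimately show "Z = Z'" using UK by blast
  qed
  have c3: "(\<lambda>Z. indic (2 * h) (?U \<union> Z)) ` ?Z \<subseteq> {y \<in> balanced (2 * h). sub \<kappa> \<iota> y = v}"
  proof (rule image_subsetI)
    fix Z assume "Z \<in> ?Z"
    then have Z: "Z \<subseteq> {..<2 * h} - ?K" "card Z = h - card ?U" by auto
    have "finite Z" using Z(1) finite_subset by blast
    moreover have "?U \<inter> Z = {}" using Z(1) UK by blast
    ultimately have "card (?U \<union> Z) = h" using Z(2) U assms(3) by (subst card_Un_disjoint) auto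
    moreover have "?U \<union> Z \<subseteq> {..<2 * h}" using Z(1) UK \<iota>(2) by blast
    ultimately have b: "indic (2 * h) (?U \<union> Z) \<in> balanced (2 * h)" by (intro indic_balanced)
    have "indic (2 * h) (?U \<union> Z) (\<iota> j) = v j" if j: "j < \<kappa>" for j
    proof -
      have "\<iota> j \<in> ?K" using j by auto
      then have 1: "\<iota> j \<notin> Z" "\<iota> j < 2 * h" using Z(1) \<iota>(2) by auto
      have "\<iota> j \<in> ?U \<longleftrightarrow> v j"
      proof
        assume "\<iota> j \<in> ?U"
        then obtain l where "l < \<kappa>" "v l" "\<iota> j = \<iota> l" by auto
        then show "v j" using inj_onD[OF \<iota>(1), of j l] j by auto
      qed (use j in auto)
      then show ?thesis using 1 by (simp add: indic_def)
    qed
    then have "sub \<kappa> \<iota> (indic (2 * h) (?U \<union> Z)) = sub \<kappa> id v" by (intro sub_cong) simp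
    then show "indic (2 * h) (?U \<union> Z) \<in> {y \<in> balanced (2 * h). sub \<kappa> \<iota> y = v}"
      using b assms(4) by simp
  qed
  have "card ?Z \<le> card {y \<in> balanced (2 * h). sub \<kappa> \<iota> y = v}"
    by (rule card_inj_on_le[OF c2 c3]) simp
  then show ?thesis using that[OF U] c1 by simp
qed

text \<open>For \<open>2 * k\<close> fair bits the probability would be \<open>(1 / 4) ^ k\<close>.
  Balance costs at most the factor (1 - 2 k / h)^(2 k), and Bernoulli's inequality bounds this below
  by 1 - 4 k^2 / h, which is 1 - 1 / (50 k) since h is half of \<open>parts k\<close>.\<close>

lemma prob_balanced_pattern:
  assumes k: "1 \<le> k" and \<iota>: "inj_on \<iota> {..<2 * k}" "\<iota> ` {..<2 * k} \<subseteq> {..<parts k}" and v: "v \<in> cube (2 * k)"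
  shows "3 / 4 * (1 / 4) ^ k \<le> measure_pmf.prob (pmf_of_set (balanced (parts k))) {y. sub (2 * k) \<iota> y = v}"
proof -
  define h where "h = 200 * k ^ 3"
  have s: "parts k = 2 * h" by (simp add: parts_def h_def)
  have kk: "k \<le> k * k" using k by simp
  have kkk: "k * k \<le> k * k * k" using k by simp
  have kh: "2 * k \<le> h" "0 < h" using k kk kkk unfolding h_def power3_eq_cube by linarith+
  let ?C = "{y \<in> balanced (2 * h). sub (2 * k) \<iota> y = v}"
  obtain a where a: "a \<le> 2 * k" "(2 * h - 2 * k) choose (h - a) \<le> card ?C"
    using card_balanced_pattern[OF \<iota>[unfolded s] kh(1) v] by blast
  have "card (balanced (2 * h)) * (h - 2 * k) ^ (2 * k) \<le> ((2 * h) choose h) * (h - 2 * k) ^ (2 * k)"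
    by (intro mult_right_mono card_balanced_le) auto
  also have "\<dots> \<le> ((2 * h - 2 * k) choose (h - a)) * (2 * h) ^ (2 * k)"
    by (rule central_binomial_restrict) (use a kh in auto)
  also have "\<dots> \<le> card ?C * (2 * h) ^ (2 * k)"
    using a(2) by (intro mult_right_mono) auto
  finally have "real (card (balanced (2 * h)) * (h - 2 * k) ^ (2 * k)) \<le> real (card ?C * (2 * h) ^ (2 * k))"
    by (rule of_nat_mono)
  then have "real (card (balanced (2 * h))) * real (h - 2 * k) ^ (2 * k) \<le> real (card ?C) * real (2 * h) ^ (2 * k)"
    by (simp only: of_nat_mult of_nat_power)
  moreover have "0 < card (balanced (2 * h))" using balanced_nonempty by (simp add: card_gt_0_iff)
  ultimately have "(real (h - 2 * k) / real (2 * h)) ^ (2 * k) \<le> real (card ?C) / real (card (balanced (2 * h)))"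
    using kh by (simp add: power_divide field_simps)
  moreover have "real (card ?C) / real (card (balanced (2 * h)))
      = measure_pmf.prob (pmf_of_set (balanced (parts k))) {y. sub (2 * k) \<iota> y = v}"
    by (simp add: s measure_pmf_of_set balanced_nonempty Int_def)
  moreover have "3 / 4 * (1 / 4) ^ k \<le> (real (h - 2 * k) / real (2 * h)) ^ (2 * k)"
  proof -
    have half: "real (h - 2 * k) / real (2 * h) = 1 / 2 * (1 - 2 * real k / real h)"
      using kh by (simp add: of_nat_diff field_simps)
    have e: "(real (h - 2 * k) / real (2 * h)) ^ (2 * k) = (1 / 4) ^ k * (1 - 2 * real k / real h) ^ (2 * k)"
      unfolding half power_mult_distrib by (simp add: power_mult power2_eq_square)
    have r: "2 * real k / real h = 1 / (100 * real k * real k)"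
      using k by (simp add: h_def power3_eq_cube)
    have "1 + real (2 * k) * (- (2 * real k / real h)) \<le> (1 + (- (2 * real k / real h))) ^ (2 * k)"
      using kh by (intro Bernoulli_inequality) (simp add: field_simps)
    moreover have "real (2 * k) * (2 * real k / real h) = 1 / (50 * real k)"
      unfolding r using k by (simp add: field_simps)
    moreover have "1 / (50 * real k) \<le> 1 / 4" using k by (simp add: field_simps)
    ultimately have "3 / 4 \<le> (1 - 2 * real k / real h) ^ (2 * k)" by simp
    then show ?thesis unfolding e by simp
  qed
  ultimately show ?thesis by linarith
qed

text \<open>The strings of a design are exactly balanced, because then \<open>sub n \<phi> y\<close> is uniform for a fixed \<open>y\<close> and a random
  labelling \<open>\<phi>\<close>. (For uniform \<open>y\<close> the point \<open>sub n \<phi> y\<close> is not uniform: two of its coordinates are correlated.)\<close>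

definition design_size :: "nat \<Rightarrow> nat" where
  "design_size k = 32 * 16 ^ k * k * parts k"

definition design :: "nat \<Rightarrow> (nat \<Rightarrow> point) \<Rightarrow> bool" where
  "design k ys \<longleftrightarrow> (\<forall>i<design_size k. ys i \<in> balanced (parts k)) \<and>
     (\<forall>\<iota> v. inj_on \<iota> {..<2 * k} \<longrightarrow> \<iota> ` {..<2 * k} \<subseteq> {..<parts k} \<longrightarrow> v \<in> cube (2 * k) \<longrightarrow>
        real (design_size k) * (1 / 2 * (1 / 4) ^ k) \<le> real (card {i. i < design_size k \<and> sub (2 * k) \<iota> (ys i) = v}))"

text \<open>Probabilistic method: independent uniform balanced strings violate the requirement for
  one embedding and pattern with probability at most exp(-4 k s), and there are fewer than exp(4 k
  s) such pairs. The slack between 3/4 and 1/2 is what Hoeffding's inequality uses.\<close>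

lemma design_exists:
  assumes k: "1 \<le> k"
  shows "\<exists>ys. design k ys"
proof -
  let ?s = "parts k" and ?m = "design_size k"
  let ?p = "pmf_of_set (balanced ?s)"
  let ?R = "Pi_pmf {..<?m} undefined (\<lambda>_. ?p)"
  have s: "0 < ?s" using k by (simp add: parts_def)
  have ne: "balanced ?s \<noteq> {}" using balanced_nonempty[of "200 * k ^ 3"] by (simp add: parts_def)
  have m: "0 < ?m" using k s by (simp add: design_size_def)
  define X where "X \<iota> v y = (if sub (2 * k) \<iota> y = v then 1 else 0 :: real)" for \<iota> v y
  define Idx where "Idx = {\<iota> \<in> labellings (2 * k) ?s. inj_on \<iota> {..<2 * k}} \<times> cube (2 * k)"
  define bad where "bad = (\<lambda>(\<iota>, v). {W. (\<Sum>i<?m. X \<iota> v (W i)) \<le> real ?m * (3 / 4 * (1 / 4) ^ k - 1 / 4 * (1 / 4) ^ k)})"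
  have each: "measure_pmf.prob ?R (bad (\<iota>, v)) \<le> exp (- 4 * real k * real ?s)" if "(\<iota>, v) \<in> Idx" for \<iota> v
  proof -
    have \<iota>: "inj_on \<iota> {..<2 * k}" "\<iota> ` {..<2 * k} \<subseteq> {..<?s}" and v: "v \<in> cube (2 * k)"
      using that by (auto simp: Idx_def labellings_def)
    have "measure_pmf.expectation ?p (X \<iota> v) = measure_pmf.prob ?p {y. sub (2 * k) \<iota> y = v}"
    proof -
      have "X \<iota> v = indicator {y. sub (2 * k) \<iota> y = v}" by (auto simp: X_def indicator_def)
      then show ?thesis by simp
    qed
    then have mu: "3 / 4 * (1 / 4) ^ k \<le> measure_pmf.expectation ?p (X \<iota> v)"
      using prob_balanced_pattern[OF k \<iota> v] by simp
    have "measure_pmf.prob ?R (bad (\<iota>, v)) \<le> exp (- 2 * real ?m * (1 / 4 * (1 / 4) ^ k)\<^sup>2)"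
      unfolding bad_def prod.case by (rule hoeffding_Pi_pmf[OF _ mu _ m]) (auto simp: X_def)
    \<comment> \<open>This equation fixes \<open>design_size\<close>: the deviation squared is 1/16
      times 16^(-k), so the factor \<open>32 * 16 ^ k * k * parts k\<close> leaves exactly 4 k
      s.\<close>
    also have "- 2 * real ?m * (1 / 4 * (1 / 4) ^ k)\<^sup>2 = - 4 * real k * real ?s"
    proof -
      have "((1 / 4 :: real) ^ k)\<^sup>2 = ((1 / 4)\<^sup>2) ^ k" by (metis power_mult mult.commute)
      then have "(1 / 4 * (1 / 4 :: real) ^ k)\<^sup>2 = 1 / 16 * (1 / 16) ^ k"
        by (simp add: power_mult_distrib power2_eq_square)
      then show ?thesis by (simp add: design_size_def power_one_over)
    qed
    finally show ?thesis .
  qed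
  have fin: "finite Idx" by (auto simp: Idx_def)
  have "card Idx \<le> card (labellings (2 * k) ?s \<times> cube (2 * k))"
    by (rule card_mono) (auto simp: Idx_def)
  then have "real (card Idx) \<le> real (card (labellings (2 * k) ?s \<times> cube (2 * k)))" by (rule of_nat_mono)
  also have "\<dots> = (2 * real ?s) ^ (2 * k)"
    by (simp add: card_cartesian_product card_labellings card_cube power_mult_distrib)
  also have "\<dots> < exp (2 * real ?s) ^ (2 * k)"
    using k exp_gt_self[of "2 * real ?s"] by (intro power_strict_mono) auto
  also have "\<dots> = exp (4 * real k * real ?s)"
    by (simp flip: exp_of_nat_mult)
  finally have cI: "real (card Idx) < exp (4 * real k * real ?s)" .
  have "measure_pmf.prob ?R (\<Union>p\<in>Idx. bad p) \<le> (\<Sum>p\<in>Idx. measure_pmf.prob ?R (bad p))"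
    using fin by (intro measure_pmf.finite_measure_subadditive_finite) auto
  also have "\<dots> \<le> (\<Sum>p\<in>Idx. exp (- 4 * real k * real ?s))"
    using each by (intro sum_mono) auto
  also have "\<dots> = real (card Idx) * exp (- 4 * real k * real ?s)" by simp
  also have "\<dots> < exp (4 * real k * real ?s) * exp (- 4 * real k * real ?s)"
    using cI by (intro mult_strict_right_mono) auto
  also have "\<dots> = 1" by (simp flip: exp_add)
  finally have lt: "measure_pmf.prob ?R (\<Union>p\<in>Idx. bad p) < 1" .
  have "\<exists>W\<in>set_pmf ?R. W \<notin> (\<Union>p\<in>Idx. bad p)"
  proof (rule ccontr)
    assume "\<not> ?thesis"
    then have "set_pmf ?R \<subseteq> (\<Union>p\<in>Idx. bad p)" by blast
    then have "measure_pmf.prob ?R (\<Union>p\<in>Idx. bad p) = 1"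
      by (subst measure_pmf.prob_eq_1) (auto simp: AE_measure_pmf_iff)
    then show False using lt by simp
  qed
  then obtain ys where ys: "ys \<in> set_pmf ?R" "\<And>p. p \<in> Idx \<Longrightarrow> ys \<notin> bad p" by blast
  have "design k ys"
    unfolding design_def
  proof (intro conjI allI impI)
    fix i assume "i < ?m"
    then show "ys i \<in> balanced ?s" using ys(1) ne by (auto simp: set_Pi_pmf PiE_dflt_def)
  next
    fix \<iota> :: "nat \<Rightarrow> nat" and v
    assume \<iota>: "inj_on \<iota> {..<2 * k}" "\<iota> ` {..<2 * k} \<subseteq> {..<?s}" and v: "v \<in> cube (2 * k)"
    \<comment> \<open>The union bound needs a finite index set, so \<open>Idx\<close> contains
      extensional embeddings only. Restricting does not change
      \<open>sub (2 * k) \<iota>\<close>.\<close>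
    let ?\<iota> = "restrict \<iota> {..<2 * k}"
    have "(?\<iota>, v) \<in> Idx" using \<iota> v by (auto simp: Idx_def labellings_def inj_on_def)
    from ys(2)[OF this] have "real ?m * (1 / 2 * (1 / 4) ^ k) < (\<Sum>i<?m. X ?\<iota> v (ys i))"
      by (simp add: bad_def not_le)
    also have "\<dots> = (\<Sum>i<?m. if sub (2 * k) \<iota> (ys i) = v then 1 else 0)"
    proof (intro sum.cong refl)
      fix i
      have "sub (2 * k) ?\<iota> (ys i) = sub (2 * k) \<iota> (ys i)" by (intro sub_cong) simp
      then show "X ?\<iota> v (ys i) = (if sub (2 * k) \<iota> (ys i) = v then 1 else 0)" by (simp add: X_def)
    qed
    also have "\<dots> = real (card {i. i < ?m \<and> sub (2 * k) \<iota> (ys i) = v})"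
      by (simp add: sum.If_cases Int_def)
    finally show "real ?m * (1 / 2 * (1 / 4) ^ k) \<le> real (card {i. i < ?m \<and> sub (2 * k) \<iota> (ys i) = v})"
      by simp
  qed
  then show ?thesis by blast
qed

text \<open>Such a \<open>q\<close> factors through \<open>2 * k\<close> bits, and every pattern of
  these bits occurs in the design at least half as often as for fair bits. Since \<open>q\<close> is
  nonnegative, lower bounds on the frequencies suffice and yield the factor 2.\<close>

lemma design_avg:
  assumes d: "design k ys" and "2 * k \<le> parts k" and K: "K \<subseteq> {..<parts k}" "card K \<le> 2 * k"
    and dep: "depends_on (parts k) K q" and nn: "\<And>y. y \<in> cube (parts k) \<Longrightarrow> 0 \<le> q y"
  shows "real (design_size k) * cube_avg (parts k) q \<le> 2 * (\<Sum>i<design_size k. q (ys i))"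
proof -
  let ?s = "parts k" and ?m = "design_size k"
  have fK: "finite K" using K(1) finite_subset by blast
  obtain K' where K': "K \<subseteq> K'" "K' \<subseteq> {..<?s}" "card K' = 2 * k"
    using exists_subset_between[of K "2 * k" "{..<?s}"] K assms(2) by auto
  have "finite K'" using K'(2) finite_subset by blast
  then obtain \<iota> where \<iota>: "bij_betw \<iota> {..<2 * k} K'"
    using ex_bij_betw_nat_finite[of K'] K'(3) by (auto simp: lessThan_atLeast0)
  have inj: "inj_on \<iota> {..<2 * k}" and img: "\<iota> ` {..<2 * k} = K'"
    using \<iota> by (auto simp: bij_betw_def)
  have img': "\<iota> ` {..<2 * k} \<subseteq> {..<?s}" using img K'(2) by simp
  \<comment> \<open>The bits outside \<open>K'\<close> are set to False; \<open>q\<close> ignores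
    them.\<close>
  define q' where "q' v = q (\<lambda>i\<in>{..<?s}. i \<in> K' \<and> v (the_inv_into {..<2 * k} \<iota> i))" for v :: point
  have q': "q' (sub (2 * k) \<iota> y) = q y" if y: "y \<in> cube ?s" for y
  proof -
    let ?y = "\<lambda>i\<in>{..<?s}. i \<in> K' \<and> sub (2 * k) \<iota> y (the_inv_into {..<2 * k} \<iota> i)"
    have "?y \<in> cube ?s" by (simp add: cube_def)
    moreover have "?y i = y i" if "i \<in> K" for i
    proof -
      have i: "i \<in> K'" "i < ?s" using that K'(1,2) by auto
      then obtain j where j: "j < 2 * k" "i = \<iota> j" using img by auto
      then have "the_inv_into {..<2 * k} \<iota> i = j" using the_inv_into_f_f[OF inj] by simp
      then show ?thesis using i j by (simp add: sub_apply)
    qed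
    ultimately show ?thesis using dep y unfolding q'_def depends_on_def by blast
  qed
  have q'_nn: "0 \<le> q' v" for v
    unfolding q'_def by (rule nn) (simp add: cube_def)
  have "cube_avg ?s q = cube_avg ?s (\<lambda>y. q' (sub (2 * k) \<iota> y))"
    by (intro cube_avg_cong) (simp add: q')
  also have "\<dots> = cube_avg (2 * k) q'" by (rule cube_avg_sub[OF inj img'])
  finally have avg: "cube_avg ?s q = (\<Sum>v\<in>cube (2 * k). q' v) * (1 / 4) ^ k"
    by (simp add: cube_avg_sum power_mult power_one_over)
  have ys: "ys i \<in> cube ?s" if "i < ?m" for i
    using d that by (auto simp: design_def balanced_def)
  have "real ?m * cube_avg ?s q = 2 * (\<Sum>v\<in>cube (2 * k). real ?m * (1 / 2 * (1 / 4) ^ k) * q' v)"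
    by (simp add: avg sum_distrib_left sum_distrib_right mult_ac)
  also have "\<dots> \<le> 2 * (\<Sum>v\<in>cube (2 * k). real (card {i. i < ?m \<and> sub (2 * k) \<iota> (ys i) = v}) * q' v)"
    using d inj img' q'_nn unfolding design_def
    by (intro mult_left_mono sum_mono mult_right_mono) auto
  also have "(\<Sum>v\<in>cube (2 * k). real (card {i. i < ?m \<and> sub (2 * k) \<iota> (ys i) = v}) * q' v)
     = (\<Sum>v\<in>cube (2 * k). \<Sum>i\<in>{i \<in> {..<?m}. sub (2 * k) \<iota> (ys i) = v}. q' (sub (2 * k) \<iota> (ys i)))"
    by (intro sum.cong refl) simp
  also have "\<dots> = (\<Sum>i<?m. q' (sub (2 * k) \<iota> (ys i)))"
    by (rule sum.group) auto
  also have "\<dots> = (\<Sum>i<?m. q (ys i))" by (intro sum.cong refl q' ys) simp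
  finally show ?thesis .
qed

section \<open>Matching two juntas by a permutation of the coordinates\<close>

lemma extend_injection_permutes:
  assumes "finite S" "A \<subseteq> S" "inj_on \<alpha> A" "\<alpha> ` A \<subseteq> S"
  obtains \<pi> where "\<pi> permutes S" "\<And>a. a \<in> A \<Longrightarrow> \<pi> a = \<alpha> a"
proof -
  have fA: "finite A" using assms(1,2) finite_subset by blast
  have "card (S - A) = card (S - \<alpha> ` A)"
    using assms fA by (simp add: card_Diff_subset card_image)
  then obtain \<beta> where \<beta>: "bij_betw \<beta> (S - A) (S - \<alpha> ` A)"
    using finite_same_card_bij[of "S - A" "S - \<alpha> ` A"] assms(1) by auto
  define \<pi> where "\<pi> x = (if x \<in> A then \<alpha> x else if x \<in> S then \<beta> x else x)" for x
  have "bij_betw \<pi> A (\<alpha> ` A)"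
    using assms(3) by (simp add: bij_betw_def inj_on_def \<pi>_def)
  moreover have "bij_betw \<pi> (S - A) (S - \<alpha> ` A)"
    using \<beta> by (rule bij_betw_cong[THEN iffD1, rotated]) (auto simp: \<pi>_def)
  ultimately have "bij_betw \<pi> (A \<union> (S - A)) (\<alpha> ` A \<union> (S - \<alpha> ` A))"
    by (rule bij_betw_combine) auto
  moreover have "A \<union> (S - A) = S" "\<alpha> ` A \<union> (S - \<alpha> ` A) = S" using assms by auto
  ultimately have "\<pi> permutes S"
    by (intro bij_imp_permutes) (use assms(2) in \<open>auto simp: \<pi>_def\<close>)
  then show ?thesis using that by (simp add: \<pi>_def)
qed

text \<open>Two juntas that agree on average after placing their variables among the parts agree on average
  after matching the variables that share a part. Unmatched variables are irrelevant on average, which the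
  three-step hybrid exploits: the intermediate points \<open>Y\<^sub>1\<close>, \<open>Y\<^sub>2\<close>, \<open>Y\<^sub>3\<close> exchange the variables of one
  junta at a time, and each of them is uniform.\<close>

lemma match_juntas:
  assumes h: "depends_on n J h" "J \<subseteq> {..<n}" "inj_on \<phi> J" "\<phi> ` {..<n} \<subseteq> {..<s}"
    and h': "depends_on n J' h'" "J' \<subseteq> {..<n}" "inj_on \<psi> J'" "\<psi> ` {..<n} \<subseteq> {..<s}"
  shows "\<exists>\<pi>. \<pi> permutes {..<n} \<and> cube_avg n (\<lambda>x. (h x - h' (sub n \<pi> x))\<^sup>2)
           \<le> 9 * cube_avg s (\<lambda>y. (h (sub n \<phi> y) - h' (sub n \<psi> y))\<^sup>2)"
proof -
  \<comment> \<open>A variable of \<open>h'\<close> is matched when its part also holds a variable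
    of \<open>h\<close>, and \<open>\<alpha>\<close> sends it to that variable. Off \<open>A\<close>
    any extension to a permutation will do.\<close>
  define A where "A = {j \<in> J'. \<psi> j \<in> \<phi> ` J}"
  define \<alpha> where "\<alpha> j = the_inv_into J \<phi> (\<psi> j)" for j
  have inv\<phi>: "the_inv_into J \<phi> (\<phi> j) = j" if "j \<in> J" for j
    using the_inv_into_f_f[OF h(3) that] .
  have inv\<psi>: "the_inv_into J' \<psi> (\<psi> j) = j" if "j \<in> J'" for j
    using the_inv_into_f_f[OF h'(3) that] .
  have \<alpha>: "\<alpha> j \<in> J" "\<phi> (\<alpha> j) = \<psi> j" if "j \<in> A" for j
    using that inv\<phi> by (auto simp: A_def \<alpha>_def)
  have "inj_on \<alpha> A"
  proof (rule inj_onI)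
    fix i j assume ij: "i \<in> A" "j \<in> A" "\<alpha> i = \<alpha> j"
    then have "\<psi> i = \<psi> j" using \<alpha>(2) by metis
    then show "i = j" using ij h'(3) by (auto simp: A_def inj_on_def)
  qed
  moreover have "A \<subseteq> {..<n}" "\<alpha> ` A \<subseteq> {..<n}" using h(2) h'(2) \<alpha>(1) by (auto simp: A_def)
  ultimately obtain \<pi> where \<pi>: "\<pi> permutes {..<n}" "\<And>j. j \<in> A \<Longrightarrow> \<pi> j = \<alpha> j"
    using extend_injection_permutes[of "{..<n}" A \<alpha>] by blast
  have \<pi>_inj: "\<pi> i = \<pi> j \<longleftrightarrow> i = j" for i j using permutes_inj[OF \<pi>(1)] by (auto simp: inj_def)
  have \<pi>_lt: "\<pi> j < n" if "j < n" for j using permutes_in_image[OF \<pi>(1), of j] that by simp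
  have match: "\<pi> j' = j" if "j \<in> J" "j' \<in> J'" "\<phi> j = \<psi> j'" for j j'
  proof -
    have "\<psi> j' \<in> \<phi> ` J" using that by (metis imageI)
    then have "j' \<in> A" using that by (simp add: A_def)
    then show ?thesis using \<pi>(2) \<alpha> that h(3) by (auto simp: inj_on_def)
  qed
  \<comment> \<open>In \<open>cube (n + s)\<close> the first \<open>n\<close> bits form x, and the
    others give each part a fresh bit. The first string puts bits of x on the parts of
    \<open>J\<close>, the second only on the common parts, the third puts permuted bits of x on the
    parts of \<open>J'\<close>. The chain is h(x) = h(Y1), h'(Y1) = h'(Y2), h(Y2) = h(Y3), and
    h'(Y3) is h' at the permuted x; its three gaps give 3 + 3 + 3 = 9.\<close>
  define \<kappa>1 where "\<kappa>1 i = (if i \<in> \<phi> ` J then the_inv_into J \<phi> i else n + i)" for i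
  define \<kappa>2 where "\<kappa>2 i = (if i \<in> \<phi> ` J \<and> i \<in> \<psi> ` J' then the_inv_into J \<phi> i else n + i)" for i
  define \<kappa>3 where "\<kappa>3 i = (if i \<in> \<psi> ` J' then \<pi> (the_inv_into J' \<psi> i) else n + i)" for i
  have J_lt: "j < n" if "j \<in> J" for j using that h(2) by auto
  have inv_lt: "the_inv_into J \<phi> i < n" if "i \<in> \<phi> ` J" for i using that J_lt by (auto simp: inv\<phi>)
  have J'_lt: "j < n" if "j \<in> J'" for j using that h'(2) by auto
  have \<kappa>1: "inj_on \<kappa>1 {..<s}" "\<kappa>1 ` {..<s} \<subseteq> {..<n + s}"
  proof -
    show "inj_on \<kappa>1 {..<s}"
    proof (rule inj_onI)
      fix a b assume "\<kappa>1 a = \<kappa>1 b"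
      then show "a = b" using J_lt by (auto simp: \<kappa>1_def inv\<phi> split: if_splits) (metis inv\<phi> not_add_less1)+
    qed
    show "\<kappa>1 ` {..<s} \<subseteq> {..<n + s}"
      by (rule image_subsetI) (auto simp: \<kappa>1_def inv\<phi> intro: trans_less_add1[OF J_lt])
  qed
  have \<kappa>2: "inj_on \<kappa>2 {..<s}" "\<kappa>2 ` {..<s} \<subseteq> {..<n + s}"
  proof -
    show "inj_on \<kappa>2 {..<s}"
    proof (rule inj_onI)
      fix a b assume "\<kappa>2 a = \<kappa>2 b"
      then show "a = b" using J_lt by (auto simp: \<kappa>2_def inv\<phi> split: if_splits) (metis inv\<phi> not_add_less1)+
    qed
    show "\<kappa>2 ` {..<s} \<subseteq> {..<n + s}"
      by (rule image_subsetI) (auto simp: \<kappa>2_def intro: trans_less_add1[OF inv_lt])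
  qed
  have \<kappa>3: "inj_on \<kappa>3 {..<s}" "\<kappa>3 ` {..<s} \<subseteq> {..<n + s}"
  proof -
    show "inj_on \<kappa>3 {..<s}"
    proof (rule inj_onI)
      fix a b assume "\<kappa>3 a = \<kappa>3 b"
      then show "a = b" using J'_lt \<pi>_lt
        by (auto simp: \<kappa>3_def inv\<psi> \<pi>_inj split: if_splits) (metis inv\<psi> not_add_less1)+
    qed
    show "\<kappa>3 ` {..<s} \<subseteq> {..<n + s}"
      by (rule image_subsetI) (auto simp: \<kappa>3_def inv\<psi> intro: trans_less_add1[OF \<pi>_lt[OF J'_lt]])
  qed
  have \<phi>_lt: "\<phi> j < s" if "j < n" for j using h(4) that by auto
  have \<psi>_lt: "\<psi> j < s" if "j < n" for j using h'(4) that by auto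
  have hcong: "h (sub n \<iota> w) = h (sub n \<iota>' w)" if "\<And>j. j \<in> J \<Longrightarrow> \<iota> j = \<iota>' j" for \<iota> \<iota>' w
    using h(1) J_lt that unfolding depends_on_def by (simp add: sub_apply)
  have h'cong: "h' (sub n \<iota> w) = h' (sub n \<iota>' w)" if "\<And>j. j \<in> J' \<Longrightarrow> \<iota> j = \<iota>' j" for \<iota> \<iota>' w
    using h'(1) J'_lt that unfolding depends_on_def by (simp add: sub_apply)
  let ?Y1 = "sub s \<kappa>1" and ?Y2 = "sub s \<kappa>2" and ?Y3 = "sub s \<kappa>3"
  have s\<phi>: "sub n \<phi> (sub s \<kappa> w) = sub n (\<kappa> \<circ> \<phi>) w" for \<kappa> w using \<phi>_lt by (rule sub_sub)
  have s\<psi>: "sub n \<psi> (sub s \<kappa> w) = sub n (\<kappa> \<circ> \<psi>) w" for \<kappa> w using \<psi>_lt by (rule sub_sub)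
  have e1: "h (sub n id w) = h (sub n \<phi> (?Y1 w))" for w
    unfolding s\<phi> by (rule hcong) (simp add: \<kappa>1_def inv\<phi>)
  have e2: "h' (sub n \<psi> (?Y1 w)) = h' (sub n \<psi> (?Y2 w))" for w
    unfolding s\<psi> by (rule h'cong) (auto simp: \<kappa>1_def \<kappa>2_def)
  have e3: "h (sub n \<phi> (?Y2 w)) = h (sub n \<phi> (?Y3 w))" for w
    unfolding s\<phi>
  proof (rule hcong)
    fix j assume j: "j \<in> J"
    show "(\<kappa>2 \<circ> \<phi>) j = (\<kappa>3 \<circ> \<phi>) j"
    proof (cases "\<phi> j \<in> \<psi> ` J'")
      case True
      then obtain j' where j': "j' \<in> J'" "\<phi> j = \<psi> j'" by auto
      have "\<kappa>2 (\<phi> j) = j" using j True by (simp add: \<kappa>2_def inv\<phi>)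
      moreover have "\<kappa>3 (\<psi> j') = j" using match[OF j j'] j'(1) by (simp add: \<kappa>3_def inv\<psi>)
      ultimately show ?thesis using j'(2) by simp
    qed (simp add: \<kappa>2_def \<kappa>3_def)
  qed
  have e4: "h' (sub n \<psi> (?Y3 w)) = h' (sub n \<pi> (sub n id w))" for w
  proof -
    have "sub n \<pi> (sub n id w) = sub n \<pi> w" using \<pi>_lt by (subst sub_sub) auto
    then show ?thesis unfolding s\<psi> by (simp only:) (rule h'cong, simp add: \<kappa>3_def inv\<psi>)
  qed
  let ?q = "\<lambda>y. (h (sub n \<phi> y) - h' (sub n \<psi> y))\<^sup>2"
  have "cube_avg n (\<lambda>x. (h x - h' (sub n \<pi> x))\<^sup>2)
      = cube_avg (n + s) (\<lambda>w. (h (sub n id w) - h' (sub n \<pi> (sub n id w)))\<^sup>2)"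
    by (rule cube_avg_sub[symmetric]) auto
  also have "\<dots> \<le> cube_avg (n + s) (\<lambda>w. 3 * ?q (?Y1 w) + 3 * ?q (?Y2 w) + 3 * ?q (?Y3 w))"
  proof (rule cube_avg_mono)
    fix w
    show "(h (sub n id w) - h' (sub n \<pi> (sub n id w)))\<^sup>2 \<le> 3 * ?q (?Y1 w) + 3 * ?q (?Y2 w) + 3 * ?q (?Y3 w)"
      using sum_squares_le3[of "h (sub n id w)" "h' (sub n \<pi> (sub n id w))" "h' (sub n \<psi> (?Y1 w))" "h (sub n \<phi> (?Y2 w))"]
      by (simp only: e1 e2 e3 e4 power2_commute)
  qed
  also have "\<dots> = 9 * cube_avg s ?q"
    by (simp only: cube_avg_add cube_avg_cmult cube_avg_sub[OF \<kappa>1, of ?q] cube_avg_sub[OF \<kappa>2, of ?q] cube_avg_sub[OF \<kappa>3, of ?q])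
  finally show ?thesis using \<pi>(1) by blast
qed

subsection \<open>The tester\<close>

text \<open>The answers are collected in the function \<open>g\<close>, so that the decision \<open>D\<close> can be stated as a property of \<open>f\<close>
  that only depends on the queried values.\<close>

primrec ask :: "point list \<Rightarrow> (bfun \<Rightarrow> bool) \<Rightarrow> bfun \<Rightarrow> query_alg" where
  "ask [] D g = Output (D g)"
| "ask (x # xs) D g = Query x (\<lambda>v. ask xs D (g(x := v)))"

lemma accepts_ask: "accepts f (ask xs D g) = D (\<lambda>x. if x \<in> set xs then f x else g x)"
proof (induction xs arbitrary: g)
  case (Cons x xs)
  have "(\<lambda>z. if z \<in> set xs then f z else (g(x := f x)) z) = (\<lambda>z. if z \<in> set (x # xs) then f z else g z)"
    by auto
  then show ?case by (simp only: ask.simps accepts.simps Cons)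
qed simp

lemma queried_ask: "queried f (ask xs D g) = xs"
  by (induction xs arbitrary: g) auto

lemma prob_mono_set_pmf:
  assumes "\<And>x. x \<in> set_pmf p \<Longrightarrow> Q x \<Longrightarrow> Q' x"
  shows "measure_pmf.prob p {x. Q x} \<le> measure_pmf.prob p {x. Q' x}"
  by (rule measure_pmf.finite_measure_mono_AE) (auto simp: AE_measure_pmf_iff assms)

lemma prob_disj_le:
  assumes "\<And>x. x \<in> set_pmf p \<Longrightarrow> Q x \<Longrightarrow> A x \<or> B x"
    and "measure_pmf.prob p {x. A x} \<le> a" "measure_pmf.prob p {x. B x} \<le> b"
  shows "measure_pmf.prob p {x. Q x} \<le> a + b"
proof -
  have "measure_pmf.prob p {x. Q x} \<le> measure_pmf.prob p {x. A x \<or> B x}"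
    using assms(1) by (rule prob_mono_set_pmf)
  also have "{x. A x \<or> B x} = {x. A x} \<union> {x. B x}" by auto
  also have "measure_pmf.prob p \<dots> \<le> measure_pmf.prob p {x. A x} + measure_pmf.prob p {x. B x}"
    by (rule measure_Un_le) auto
  finally show ?thesis using assms(2,3) by linarith
qed

lemma l2_dist_cube_avg: "l2_dist n f g = sqrt (cube_avg n (\<lambda>x. (f x - g x)\<^sup>2))"
  by (simp add: l2_dist_def cube_avg_def)

lemma bfuns_bounds: "f \<in> bfuns n \<Longrightarrow> x \<in> cube n \<Longrightarrow> f x \<in> {0..1}"
  unfolding bfuns_def by (erule PiE_mem)

lemma relabel_eq_sub:
  assumes "\<pi> permutes {..<n}" "x \<in> cube n"
  shows "relabel n \<pi> f x = f (sub n \<pi> x)"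
proof -
  have "x \<circ> \<pi> = sub n \<pi> x"
  proof
    fix j
    show "(x \<circ> \<pi>) j = sub n \<pi> x j"
    proof (cases "j < n")
      case False
      then have "\<pi> j = j" using assms(1) by (simp add: permutes_not_in)
      moreover have "x j = undefined" using PiE_arb[OF assms(2)[unfolded cube_def]] False by simp
      ultimately show ?thesis using False by (simp add: sub_def)
    qed (simp add: sub_def)
  qed
  then show ?thesis using assms(2) by (simp add: relabel_def)
qed

section \<open>The two tests and the points they query\<close>

definition resample :: "nat \<Rightarrow> bfun \<Rightarrow> nat set \<Rightarrow> point \<Rightarrow> real" where
  "resample n f S w = (f (sub n id w) - f (sub n (mix n S) w))\<^sup>2"

lemma dev_resample: "dev n f S = cube_avg (2 * n) (resample n f S)"
  by (simp add: dev_def resample_def[abs_def])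

text \<open>The threshold is 20 times the bound \<open>4 * \<eta>\<close> that
  \<open>dev_junta_le\<close> gives for \<open>f\<close> in \<open>P\<close>. All sets
  \<open>A\<close> share the same samples \<open>W\<close>.\<close>

definition influence_test :: "nat \<Rightarrow> nat \<Rightarrow> nat \<Rightarrow> real \<Rightarrow> (nat \<Rightarrow> nat) \<Rightarrow> (nat \<Rightarrow> point) \<Rightarrow> bfun \<Rightarrow> bool" where
  "influence_test n k m \<eta> \<phi> W f \<longleftrightarrow>
     (\<exists>A\<subseteq>{..<parts k}. card A = k \<and> (\<Sum>i<m. resample n f (preim n \<phi> A) (W i)) \<le> real m * (80 * \<eta>))"

text \<open>For \<open>f\<close> in \<open>P\<close> the intended witnesses are its own
  approximating junta, \<open>\<psi> = \<phi>\<close> and \<open>p = f\<close>. The labelling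
  \<open>\<psi>\<close> is free because the true placement of the variables is unknown to the
  tester.\<close>

definition core_test :: "nat \<Rightarrow> nat \<Rightarrow> (nat \<Rightarrow> point) \<Rightarrow> bfun set \<Rightarrow> real \<Rightarrow> (nat \<Rightarrow> nat) \<Rightarrow> bfun \<Rightarrow> bool" where
  "core_test n k ys P \<eta> \<phi> f \<longleftrightarrow>
     (\<exists>h J \<psi> p. J \<subseteq> {..<n} \<and> card J \<le> k \<and> depends_on n J h \<and> \<psi> \<in> labellings n (parts k) \<and> inj_on \<psi> J \<and>
        p \<in> P \<and> cube_avg n (\<lambda>x. (h x - p x)\<^sup>2) \<le> \<eta> \<and>
        (\<Sum>i<design_size k. (f (sub n \<phi> (ys i)) - h (sub n \<psi> (ys i)))\<^sup>2) \<le> real (design_size k) * (20 * \<eta>))"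

definition query_set :: "nat \<Rightarrow> nat \<Rightarrow> nat \<Rightarrow> (nat \<Rightarrow> point) \<Rightarrow> (nat \<Rightarrow> nat) \<Rightarrow> (nat \<Rightarrow> point) \<Rightarrow> point set" where
  "query_set n k m ys \<phi> W =
     (\<lambda>i. sub n id (W i)) ` {..<m}
     \<union> (\<lambda>(i, A). sub n (mix n (preim n \<phi> A)) (W i)) ` ({..<m} \<times> {A. A \<subseteq> {..<parts k} \<and> card A = k})
     \<union> (\<lambda>i. sub n \<phi> (ys i)) ` {..<design_size k}"

lemma finite_query_set: "finite (query_set n k m ys \<phi> W)"
  by (simp add: query_set_def)

lemma query_set_subset: "query_set n k m ys \<phi> W \<subseteq> cube n"
  by (auto simp: query_set_def)

lemma card_query_set: "card (query_set n k m ys \<phi> W) \<le> m * (1 + (parts k choose k)) + design_size k"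
proof -
  have "card ((\<lambda>i. sub n id (W i)) ` {..<m}) \<le> m"
    using card_image_le[of "{..<m}"] by simp
  moreover have "card ((\<lambda>(i, A). sub n (mix n (preim n \<phi> A)) (W i)) ` ({..<m} \<times> {A. A \<subseteq> {..<parts k} \<and> card A = k}))
      \<le> m * (parts k choose k)"
    by (rule order_trans[OF card_image_le]) (auto simp: card_cartesian_product n_subsets)
  moreover have "card ((\<lambda>i. sub n \<phi> (ys i)) ` {..<design_size k}) \<le> design_size k"
    using card_image_le[of "{..<design_size k}"] by simp
  ultimately show ?thesis
    unfolding query_set_def
    by (intro order_trans[OF card_Un_le] order_trans[OF add_mono[OF card_Un_le order_refl]]) simp
qed

lemma influence_test_cong:
  assumes "\<And>x. x \<in> query_set n k m ys \<phi> W \<Longrightarrow> f x = g x"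
  shows "influence_test n k m \<eta> \<phi> W f = influence_test n k m \<eta> \<phi> W g"
proof -
  have "resample n f (preim n \<phi> A) (W i) = resample n g (preim n \<phi> A) (W i)"
    if "A \<subseteq> {..<parts k}" "card A = k" "i < m" for A i
  proof -
    have "sub n id (W i) \<in> query_set n k m ys \<phi> W" using that by (simp add: query_set_def)
    moreover have "sub n (mix n (preim n \<phi> A)) (W i) \<in> query_set n k m ys \<phi> W"
      using that unfolding query_set_def by blast
    ultimately show ?thesis using assms by (simp add: resample_def)
  qed
  then have "(\<Sum>i<m. resample n f (preim n \<phi> A) (W i)) = (\<Sum>i<m. resample n g (preim n \<phi> A) (W i))"
    if "A \<subseteq> {..<parts k}" "card A = k" for A
    using that by (intro sum.cong refl) simp
  then show ?thesis unfolding influence_test_def by auto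
qed

lemma core_test_cong:
  assumes "\<And>x. x \<in> query_set n k m ys \<phi> W \<Longrightarrow> f x = g x"
  shows "core_test n k ys P \<eta> \<phi> f = core_test n k ys P \<eta> \<phi> g"
proof -
  have "f (sub n \<phi> (ys i)) = g (sub n \<phi> (ys i))" if "i < design_size k" for i
    by (rule assms) (use that in \<open>simp add: query_set_def\<close>)
  then have "(\<Sum>i<design_size k. (f (sub n \<phi> (ys i)) - h (sub n \<psi> (ys i)))\<^sup>2)
      = (\<Sum>i<design_size k. (g (sub n \<phi> (ys i)) - h (sub n \<psi> (ys i)))\<^sup>2)" for h \<psi>
    by (intro sum.cong refl) simp
  then show ?thesis unfolding core_test_def by simp
qed

lemma expectation_sample_sum:
  "measure_pmf.expectation (Pi_pmf {..<m} d (\<lambda>_. pmf_of_set (cube N))) (\<lambda>W. \<Sum>i<m. X (W i))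
     = real m * cube_avg N X"
proof -
  let ?R = "Pi_pmf {..<m} d (\<lambda>_. pmf_of_set (cube N))"
  have fin: "finite (set_pmf ?R)" by (auto simp: set_Pi_pmf)
  have "measure_pmf.expectation ?R (\<lambda>W. X (W i)) = cube_avg N X" if "i < m" for i
  proof -
    have "measure_pmf.expectation (map_pmf (\<lambda>W. W i) ?R) X = measure_pmf.expectation ?R (\<lambda>W. X (W i))"
      by (rule integral_map_pmf)
    moreover have "map_pmf (\<lambda>W. W i) ?R = pmf_of_set (cube N)" using that by (simp add: Pi_pmf_component)
    ultimately show ?thesis by (simp add: cube_avg_def)
  qed
  moreover have "measure_pmf.expectation ?R (\<lambda>W. \<Sum>i<m. X (W i)) = (\<Sum>i<m. measure_pmf.expectation ?R (\<lambda>W. X (W i)))"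
    by (intro Bochner_Integration.integral_sum integrable_measure_pmf_finite fin)
  ultimately show ?thesis by simp
qed

text \<open>The queried points are dependent, but balance makes each of them uniform, so the mean is
  known and Markov's inequality suffices. Completeness uses it with \<open>\<eta>\<close>, soundness
  with \<open>640 * \<eta>\<close>.\<close>

lemma prob_core_samples:
  assumes d: "design k ys" and k: "1 \<le> k" and \<eta>: "0 < \<eta>" and avg: "cube_avg n (\<lambda>x. (f x - h x)\<^sup>2) \<le> \<eta>"
  shows "measure_pmf.prob (pmf_of_set (labellings n (parts k)))
      {\<phi>. (\<Sum>i<design_size k. (f (sub n \<phi> (ys i)) - h (sub n \<phi> (ys i)))\<^sup>2) > real (design_size k) * (20 * \<eta>)} \<le> 1 / 20"
proof (rule markov_pmf)
  let ?p = "pmf_of_set (labellings n (parts k))" and ?q = "\<lambda>x. (f x - h x)\<^sup>2"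
  have s: "0 < parts k" using k by (simp add: parts_def)
  have fin: "finite (set_pmf ?p)" using labellings_nonempty[OF s] by simp
  then show "finite (set_pmf ?p)" .
  show "0 < real (design_size k) * (20 * \<eta>)" using k \<eta> s by (simp add: design_size_def)
  have "measure_pmf.expectation ?p (\<lambda>\<phi>. \<Sum>i<design_size k. ?q (sub n \<phi> (ys i)))
     = (\<Sum>i<design_size k. measure_pmf.expectation ?p (\<lambda>\<phi>. ?q (sub n \<phi> (ys i))))"
    by (intro Bochner_Integration.integral_sum integrable_measure_pmf_finite fin)
  also have "\<dots> = (\<Sum>i<design_size k. cube_avg n ?q)"
    by (intro sum.cong refl labellings_avg_balanced) (use d s in \<open>auto simp: design_def\<close>)
  also have "\<dots> \<le> real (design_size k) * \<eta>" using avg by (simp add: mult_left_mono)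
  finally show "measure_pmf.expectation ?p (\<lambda>\<phi>. \<Sum>i<design_size k. ?q (sub n \<phi> (ys i)))
      \<le> 1 / 20 * (real (design_size k) * (20 * \<eta>))" by simp
qed (simp add: sum_nonneg)

text \<open>The design is a fixed ingredient of the algorithm; only the labelling and the samples
  are random. The lower bound on \<open>m\<close> makes Hoeffding's inequality strong enough for a
  union over all choices of \<open>k\<close> parts.\<close>

locale tester_setup =
  fixes n k :: nat and \<epsilon> \<eta> :: real and P :: "bfun set" and ys :: "nat \<Rightarrow> point" and m :: nat
  assumes eps: "0 < \<epsilon>" and property: "is_property n P" and k: "1 \<le> k"
    and close: "\<And>f. f \<in> P \<Longrightarrow> \<exists>h\<in>bfuns n. junta n k h \<and> l2_dist n f h \<le> \<epsilon> / 10 ^ 6"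
    and design: "design k ys"
    and eta: "\<eta> = (\<epsilon> / 10 ^ 6)\<^sup>2"
    and m: "real (parts k) / \<eta>\<^sup>2 \<le> real m"
begin

abbreviation "s \<equiv> parts k"
abbreviation "labels \<equiv> pmf_of_set (labellings n s)"
abbreviation "samples \<equiv> Pi_pmf {..<m} undefined (\<lambda>_. pmf_of_set (cube (2 * n)))"
abbreviation "coins \<equiv> pair_pmf labels samples"
abbreviation "T1 \<equiv> influence_test n k m \<eta>"
abbreviation "T2 \<equiv> core_test n k ys P \<eta>"

definition queries :: "(nat \<Rightarrow> nat) \<Rightarrow> (nat \<Rightarrow> point) \<Rightarrow> point list" where
  "queries \<phi> W = (SOME xs. set xs = query_set n k m ys \<phi> W \<and> distinct xs)"

text \<open>The value 0 assumed off the queried points is immaterial, since both tests depend on the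
  values on \<open>query_set\<close> only.\<close>

definition tester :: rand_alg where
  "tester = map_pmf (\<lambda>(\<phi>, W). ask (queries \<phi> W) (\<lambda>f. T1 \<phi> W f \<and> T2 \<phi> f) (\<lambda>_. 0)) coins"

lemma queries: "set (queries \<phi> W) = query_set n k m ys \<phi> W" "distinct (queries \<phi> W)"
proof -
  have "\<exists>xs. set xs = query_set n k m ys \<phi> W \<and> distinct xs"
    by (rule finite_distinct_list[OF finite_query_set])
  from someI_ex[OF this] show "set (queries \<phi> W) = query_set n k m ys \<phi> W" "distinct (queries \<phi> W)"
    unfolding queries_def by auto
qed

lemma accepts_tester:
  "accepts f (ask (queries \<phi> W) (\<lambda>f. T1 \<phi> W f \<and> T2 \<phi> f) (\<lambda>_. 0)) \<longleftrightarrow> T1 \<phi> W f \<and> T2 \<phi> f"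
proof -
  let ?f = "\<lambda>x. if x \<in> set (queries \<phi> W) then f x else 0"
  have "T1 \<phi> W ?f = T1 \<phi> W f" by (rule influence_test_cong[of n k m ys]) (simp add: queries)
  moreover have "T2 \<phi> ?f = T2 \<phi> f" by (rule core_test_cong[of n k m ys \<phi> W]) (simp add: queries)
  ultimately show ?thesis by (simp add: accepts_ask)
qed

lemma accept_prob_tester: "accept_prob tester f = measure_pmf.prob coins {(\<phi>, W). T1 \<phi> W f \<and> T2 \<phi> f}"
  unfolding accept_prob_def tester_def
  by (simp add: vimage_def case_prod_unfold accepts_tester)

lemma reject_prob_eq: "reject_prob T f = 1 - accept_prob T f"
proof -
  have "{t. \<not> accepts f t} = space (measure_pmf T) - {t. accepts f t}" by auto
  then show ?thesis unfolding reject_prob_def accept_prob_def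
    by (simp only: measure_pmf.prob_compl sets_measure_pmf UNIV_I)
qed

lemma valid_tester: "valid_alg n tester"
  unfolding valid_alg_def tester_def using query_set_subset by (auto simp: queried_ask queries)

lemma query_complexity_tester:
  "query_complexity n tester \<le> ereal (real (m * (1 + (s choose k)) + design_size k))"
  unfolding query_complexity_def
proof (intro SUP_least)
  fix t f assume "t \<in> set_pmf tester"
  then obtain \<phi> W where "t = ask (queries \<phi> W) (\<lambda>f. T1 \<phi> W f \<and> T2 \<phi> f) (\<lambda>_. 0)"
    by (auto simp: tester_def)
  then have "length (queried f t) = card (query_set n k m ys \<phi> W)"
    using queries[of \<phi> W] distinct_card by (metis queried_ask)
  then show "ereal (real (length (queried f t))) \<le> ereal (real (m * (1 + (s choose k)) + design_size k))"
    using card_query_set[of n k m ys \<phi> W] by (simp only: ereal_less_eq of_nat_le_iff)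
qed

lemma s_pos: "0 < s" using k by (simp add: parts_def)

lemma k_le_s: "2 * k \<le> s"
proof -
  have "k * 1 \<le> k * (k * k)" using k by (intro mult_le_mono) auto
  then show ?thesis by (simp add: parts_def power3_eq_cube)
qed

lemma eta_pos: "0 < \<eta>" using eps by (simp add: eta)

lemma m_pos: "0 < m"
proof -
  have "0 < real s / \<eta>\<^sup>2" using s_pos eta_pos by simp
  then show ?thesis using m by linarith
qed

lemma labels_set: "set_pmf labels = labellings n s"
  using labellings_nonempty[OF s_pos] by simp

lemma samples_finite: "finite (set_pmf samples)"
  by (auto simp: set_Pi_pmf)

lemma prob_coins_fst: "measure_pmf.prob labels {\<phi>. Q \<phi>} \<le> c \<Longrightarrow> measure_pmf.prob coins {x. Q (fst x)} \<le> c"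
  using prob_pair_pmf_fst[of labels samples Q] by (simp add: case_prod_unfold)

lemma completeness:
  assumes f: "f \<in> P"
  shows "2 / 3 \<le> accept_prob tester f"
proof -
  obtain h where h: "h \<in> bfuns n" "junta n k h" "l2_dist n f h \<le> \<epsilon> / 10 ^ 6" using close[OF f] by blast
  then obtain J where J: "J \<subseteq> {..<n}" "card J \<le> k" "depends_on n J h"
    unfolding junta_def depends_on_def by blast
  have fh: "cube_avg n (\<lambda>x. (f x - h x)\<^sup>2) \<le> \<eta>"
    using h(3) unfolding l2_dist_cube_avg eta by (rule sqrt_le_D)
  have hf: "cube_avg n (\<lambda>x. (h x - f x)\<^sup>2) \<le> \<eta>" using fh by (simp add: power2_commute)
  have fJ: "finite J" using J(1) finite_subset by blast
  have 1: "measure_pmf.prob coins {x. \<not> T1 (fst x) (snd x) f} \<le> 1 / 20"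
  proof -
    have "measure_pmf.prob coins {(\<phi>, W). \<not> T1 \<phi> W f} \<le> 1 / 20"
    proof (rule prob_pair_pmf_le)
      fix \<phi> assume "\<phi> \<in> set_pmf labels"
      then have "\<phi> \<in> labellings n s" by (simp only: labels_set)
      then have \<phi>: "\<phi> ` {..<n} \<subseteq> {..<s}" by (auto simp: labellings_def)
      have "card (\<phi> ` J) \<le> k" using card_image_le[OF fJ] J(2) order_trans by blast
      moreover have "\<phi> ` J \<subseteq> {..<s}" using \<phi> J(1) by blast
      \<comment> \<open>Variables may share a part, and \<open>J\<close> may be small, so the
        occupied parts are padded to exactly \<open>k\<close>.\<close>
      ultimately obtain A where A: "\<phi> ` J \<subseteq> A" "A \<subseteq> {..<s}" "card A = k"
        using exists_subset_between[of "\<phi> ` J" k "{..<s}"] k_le_s by auto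
      let ?X = "resample n f (preim n \<phi> A)"
      have "J \<subseteq> preim n \<phi> A" using A(1) J(1) by (auto simp: preim_def)
      then have "dev n f (preim n \<phi> A) \<le> 4 * \<eta>"
        using dev_junta_le[OF J(3) _ J(1), of "preim n \<phi> A" f] fh by linarith
      then have "real m * cube_avg (2 * n) ?X \<le> real m * (4 * \<eta>)"
        unfolding dev_resample by (intro mult_left_mono) auto
      then have "measure_pmf.prob samples {W. (\<Sum>i<m. ?X (W i)) > real m * (80 * \<eta>)} \<le> 1 / 20"
      proof (intro markov_pmf samples_finite)
        show "0 < real m * (80 * \<eta>)" using m_pos eta_pos by simp
        show "measure_pmf.expectation samples (\<lambda>W. \<Sum>i<m. ?X (W i)) \<le> 1 / 20 * (real m * (80 * \<eta>))"
          unfolding expectation_sample_sum using \<open>real m * cube_avg (2 * n) ?X \<le> real m * (4 * \<eta>)\<close> by (simp add: mult_ac)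
      qed (simp add: sum_nonneg resample_def)
      moreover have "measure_pmf.prob samples {W. \<not> T1 \<phi> W f}
          \<le> measure_pmf.prob samples {W. (\<Sum>i<m. ?X (W i)) > real m * (80 * \<eta>)}"
        by (rule prob_mono_set_pmf) (use A in \<open>auto simp: influence_test_def not_le\<close>)
      ultimately show "measure_pmf.prob samples {W. \<not> T1 \<phi> W f} \<le> 1 / 20" by linarith
    qed
    then show ?thesis by (simp add: case_prod_unfold)
  qed
  have "measure_pmf.prob labels {\<phi>. \<not> T2 \<phi> f} \<le> 1 / 20 + 1 / 20"
  proof (rule prob_disj_le[OF _ prob_not_inj_parts[OF J(1,2) k] prob_core_samples[OF design k eta_pos fh]])
    fix \<phi> assume "\<phi> \<in> set_pmf labels" "\<not> T2 \<phi> f"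
    then show "\<not> inj_on \<phi> J \<or> real (design_size k) * (20 * \<eta>)
        < (\<Sum>i<design_size k. (f (sub n \<phi> (ys i)) - h (sub n \<phi> (ys i)))\<^sup>2)"
      using J f hf unfolding core_test_def labels_set not_le[symmetric] by blast
  qed
  from prob_coins_fst[OF this] have 2: "measure_pmf.prob coins {x. \<not> T2 (fst x) f} \<le> 1 / 10" by simp
  have "measure_pmf.prob coins {x. \<not> (T1 (fst x) (snd x) f \<and> T2 (fst x) f)} \<le> 1 / 20 + 1 / 10"
    by (rule prob_disj_le[OF _ 1 2]) blast
  moreover have "measure_pmf.prob coins {x. \<not> (T1 (fst x) (snd x) f \<and> T2 (fst x) f)}
      = 1 - measure_pmf.prob coins {(\<phi>, W). T1 \<phi> W f \<and> T2 \<phi> f}"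
  proof -
    have "{x. \<not> (T1 (fst x) (snd x) f \<and> T2 (fst x) f)} = space (measure_pmf coins) - {(\<phi>, W). T1 \<phi> W f \<and> T2 \<phi> f}"
      by auto
    then show ?thesis by (simp only: measure_pmf.prob_compl sets_measure_pmf UNIV_I)
  qed
  ultimately show ?thesis by (simp add: accept_prob_tester)
qed

text \<open>Acceptance needs an exceptional labelling, for which some union of \<open>k\<close>
  parts has \<open>dev\<close> at most \<open>160 * \<eta>\<close>, or a sampling error of
  \<open>80 * \<eta>\<close> down to the threshold. The constant is 640 = 4 * 160, as
  \<open>prob_dev_small\<close> requires.\<close>

lemma influence_test_far:
  assumes f: "f \<in> bfuns n" and far: "\<And>J. J \<subseteq> {..<n} \<Longrightarrow> card J \<le> k \<Longrightarrow> 640 * \<eta> < dev n f J"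
  shows "measure_pmf.prob coins {x. T1 (fst x) (snd x) f} \<le> 1 / 10"
proof -
  define bad where "bad \<phi> \<longleftrightarrow> (\<exists>A\<subseteq>{..<s}. card A = k \<and> dev n f (preim n \<phi> A) \<le> 160 * \<eta>)" for \<phi>
  have "measure_pmf.prob labels {\<phi>. bad \<phi>} \<le> 1 / 20"
    unfolding bad_def by (rule prob_dev_small[OF k]) (use far in auto)
  note 1 = prob_coins_fst[OF this]
  have "measure_pmf.prob coins {(\<phi>, W). \<not> bad \<phi> \<and> T1 \<phi> W f} \<le> 1 / 20"
  proof (rule prob_pair_pmf_le)
    fix \<phi>
    show "measure_pmf.prob samples {W. \<not> bad \<phi> \<and> T1 \<phi> W f} \<le> 1 / 20"
    proof (cases "bad \<phi>")
      case False
      let ?A = "{A. A \<subseteq> {..<s} \<and> card A = k}"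
      let ?E = "\<lambda>A. {W. (\<Sum>i<m. resample n f (preim n \<phi> A) (W i)) \<le> real m * (160 * \<eta> - 80 * \<eta>)}"
      have each: "measure_pmf.prob samples (?E A) \<le> exp (- 2 * real m * (80 * \<eta>)\<^sup>2)" if A: "A \<in> ?A" for A
      proof (rule hoeffding_Pi_pmf)
        show "160 * \<eta> \<le> measure_pmf.expectation (pmf_of_set (cube (2 * n))) (resample n f (preim n \<phi> A))"
          using False A unfolding bad_def by (fastforce simp: dev_resample cube_avg_def)
        show "resample n f (preim n \<phi> A) w \<in> {0..1}" for w
        proof -
          have "\<bar>f (sub n id w) - f (sub n (mix n (preim n \<phi> A)) w)\<bar> \<le> 1"
            using bfuns_bounds[OF f, of "sub n id w"] bfuns_bounds[OF f, of "sub n (mix n (preim n \<phi> A)) w"]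
            by (auto simp: abs_le_iff)
          then show ?thesis by (simp add: resample_def abs_square_le_1)
        qed
      qed (use eta_pos m_pos in auto)
      have "measure_pmf.prob samples {W. \<not> bad \<phi> \<and> T1 \<phi> W f} \<le> measure_pmf.prob samples (\<Union>A\<in>?A. ?E A)"
        by (rule measure_pmf.finite_measure_mono) (auto simp: influence_test_def)
      also have "\<dots> \<le> (\<Sum>A\<in>?A. measure_pmf.prob samples (?E A))"
        by (intro measure_pmf.finite_measure_subadditive_finite) auto
      also have "\<dots> \<le> (\<Sum>A\<in>?A. exp (- 2 * real m * (80 * \<eta>)\<^sup>2))"
        by (intro sum_mono each)
      also have "\<dots> = real (s choose k) * exp (- 2 * real m * (80 * \<eta>)\<^sup>2)" by (simp add: n_subsets)
      \<comment> \<open>There are at most 2^s choices of \<open>A\<close>, while the choice of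
        \<open>m\<close> makes the Hoeffding exponent at least 12800 s, of which 20 s is
        enough.\<close>
      also have "\<dots> \<le> exp (real s) * exp (- 20 * real s)"
      proof (intro mult_mono)
        have "real (s choose k) \<le> real (2 ^ s)" by (intro of_nat_mono binomial_le_pow2)
        also have "\<dots> \<le> exp 1 ^ s" using exp_ge_add_one_self[of 1] by (simp add: power_mono)
        also have "\<dots> = exp (real s)" by (simp flip: exp_of_nat_mult)
        finally show "real (s choose k) \<le> exp (real s)" .
        have "real s \<le> real m * \<eta>\<^sup>2" using m eta_pos by (simp add: field_simps)
        then show "exp (- 2 * real m * (80 * \<eta>)\<^sup>2) \<le> exp (- 20 * real s)"
          using s_pos by (simp add: power_mult_distrib)
      qed auto
      also have "\<dots> = exp (- (19 * real s))" by (simp flip: exp_add)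
      also have "\<dots> \<le> 1 / 20"
      proof -
        have "20 \<le> 1 + 19 * real s" using s_pos by simp
        also have "\<dots> \<le> exp (19 * real s)" by (rule exp_ge_add_one_self)
        finally show ?thesis by (simp add: exp_minus field_simps)
      qed
      finally show ?thesis .
    qed simp
  qed
  then have 2: "measure_pmf.prob coins {x. \<not> bad (fst x) \<and> T1 (fst x) (snd x) f} \<le> 1 / 20"
    by (simp add: case_prod_unfold)
  have "measure_pmf.prob coins {x. T1 (fst x) (snd x) f} \<le> 1 / 20 + 1 / 20"
    by (rule prob_disj_le[OF _ 1 2]) blast
  then show ?thesis by simp
qed

text \<open>This is the deterministic part of soundness. The answers tie \<open>h\<close> to the
  accepted placement of \<open>h'\<close> on the design, hence on average over all strings of part
  bits. Matching carries this back to \<open>cube n\<close>, and the permutation is then absorbed by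
  relabelling \<open>p\<close>.\<close>

lemma core_test_close:
  assumes f: "f \<in> bfuns n" and h: "J \<subseteq> {..<n}" "card J \<le> k" "depends_on n J h"
    and fh: "cube_avg n (\<lambda>x. (f x - h x)\<^sup>2) \<le> 640 * \<eta>"
    and \<phi>: "\<phi> \<in> labellings n s" "inj_on \<phi> J"
    and emp: "(\<Sum>i<design_size k. (f (sub n \<phi> (ys i)) - h (sub n \<phi> (ys i)))\<^sup>2) \<le> real (design_size k) * (20 * (640 * \<eta>))"
    and acc: "T2 \<phi> f"
  shows "\<exists>p\<in>P. l2_dist n f p < \<epsilon>"
proof -
  let ?m = "design_size k"
  obtain h' J' \<psi> p where h': "J' \<subseteq> {..<n}" "card J' \<le> k" "depends_on n J' h'"
    and \<psi>: "\<psi> \<in> labellings n s" "inj_on \<psi> J'" and p: "p \<in> P" "cube_avg n (\<lambda>x. (h' x - p x)\<^sup>2) \<le> \<eta>"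
    and emp': "(\<Sum>i<?m. (f (sub n \<phi> (ys i)) - h' (sub n \<psi> (ys i)))\<^sup>2) \<le> real ?m * (20 * \<eta>)"
    using acc unfolding core_test_def by blast
  have \<phi>_lt: "\<phi> ` {..<n} \<subseteq> {..<s}" and \<psi>_lt: "\<psi> ` {..<n} \<subseteq> {..<s}"
    using \<phi>(1) \<psi>(1) by (auto simp: labellings_def)
  let ?q = "\<lambda>y. (h (sub n \<phi> y) - h' (sub n \<psi> y))\<^sup>2"
  let ?K = "\<phi> ` J \<union> \<psi> ` J'"
  have fJ: "finite J" "finite J'" using h(1) h'(1) finite_subset by blast+
  have K: "?K \<subseteq> {..<s}" using \<phi>_lt \<psi>_lt h(1) h'(1) by blast
  have cK: "card ?K \<le> 2 * k"
    using card_Un_le[of "\<phi> ` J" "\<psi> ` J'"] card_image_le[OF fJ(1), of \<phi>] card_image_le[OF fJ(2), of \<psi>] h(2) h'(2)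
    by linarith
  have dep: "depends_on s ?K ?q"
    unfolding depends_on_def
  proof (intro ballI impI)
    fix y z :: point assume "\<forall>i\<in>?K. y i = z i"
    then have "\<forall>j\<in>J. sub n \<phi> y j = sub n \<phi> z j" "\<forall>j\<in>J'. sub n \<psi> y j = sub n \<psi> z j"
      using h(1) h'(1) by (auto simp: sub_def)
    then have "h (sub n \<phi> y) = h (sub n \<phi> z)" "h' (sub n \<psi> y) = h' (sub n \<psi> z)"
      using h(3) h'(3) unfolding depends_on_def by simp_all
    then show "?q y = ?q z" by simp
  qed
  have "(\<Sum>i<?m. ?q (ys i)) \<le> (\<Sum>i<?m. 2 * (f (sub n \<phi> (ys i)) - h (sub n \<phi> (ys i)))\<^sup>2
      + 2 * (f (sub n \<phi> (ys i)) - h' (sub n \<psi> (ys i)))\<^sup>2)"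
  proof (rule sum_mono)
    fix i
    show "?q (ys i) \<le> 2 * (f (sub n \<phi> (ys i)) - h (sub n \<phi> (ys i)))\<^sup>2 + 2 * (f (sub n \<phi> (ys i)) - h' (sub n \<psi> (ys i)))\<^sup>2"
      using sum_squares_le2[of "h (sub n \<phi> (ys i))" "h' (sub n \<psi> (ys i))" "f (sub n \<phi> (ys i))"]
      by (simp add: power2_commute)
  qed
  also have "\<dots> \<le> 2 * (real ?m * (20 * (640 * \<eta>))) + 2 * (real ?m * (20 * \<eta>))"
    unfolding sum.distrib sum_distrib_left[symmetric] using emp emp' by (intro add_mono mult_left_mono) auto
  finally have "real ?m * cube_avg s ?q \<le> 2 * (2 * (real ?m * (20 * (640 * \<eta>))) + 2 * (real ?m * (20 * \<eta>)))"
    using design_avg[OF design k_le_s K cK dep] by simp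
  \<comment> \<open>51280 = 2 * (2 * 20 * 640 + 2 * 20), the outer 2 being the loss of
    \<open>design_avg\<close>.\<close>
  then have "real ?m * cube_avg s ?q \<le> real ?m * (51280 * \<eta>)" by (simp add: algebra_simps)
  moreover have "0 < real ?m" using k s_pos by (simp add: design_size_def)
  ultimately have q: "cube_avg s ?q \<le> 51280 * \<eta>" by (rule mult_left_le_imp_le)
  obtain \<pi> where \<pi>: "\<pi> permutes {..<n}"
    "cube_avg n (\<lambda>x. (h x - h' (sub n \<pi> x))\<^sup>2) \<le> 9 * cube_avg s ?q"
    using match_juntas[OF h(3,1) \<phi>(2) \<phi>_lt h'(3,1) \<psi>(2) \<psi>_lt] by blast
  let ?p = "relabel n \<pi> p"
  have "inj_on \<pi> {..<n}" "\<pi> ` {..<n} \<subseteq> {..<n}"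
    using permutes_inj_on[OF \<pi>(1)] permutes_image[OF \<pi>(1)] by auto
  from cube_avg_sub[OF this, of "\<lambda>x. (h' x - p x)\<^sup>2"]
  have hp: "cube_avg n (\<lambda>x. (h' (sub n \<pi> x) - p (sub n \<pi> x))\<^sup>2) \<le> \<eta>" using p(2) by simp
  have "cube_avg n (\<lambda>x. (f x - ?p x)\<^sup>2) \<le> cube_avg n (\<lambda>x. 3 * (f x - h x)\<^sup>2
      + 3 * (h x - h' (sub n \<pi> x))\<^sup>2 + 3 * (h' (sub n \<pi> x) - p (sub n \<pi> x))\<^sup>2)"
  proof (rule cube_avg_mono)
    fix x assume "x \<in> cube n"
    then show "(f x - ?p x)\<^sup>2 \<le> 3 * (f x - h x)\<^sup>2
      + 3 * (h x - h' (sub n \<pi> x))\<^sup>2 + 3 * (h' (sub n \<pi> x) - p (sub n \<pi> x))\<^sup>2"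
      by (simp only: relabel_eq_sub[OF \<pi>(1)] sum_squares_le3)
  qed
  also have "\<dots> = 3 * cube_avg n (\<lambda>x. (f x - h x)\<^sup>2) + 3 * cube_avg n (\<lambda>x. (h x - h' (sub n \<pi> x))\<^sup>2)
      + 3 * cube_avg n (\<lambda>x. (h' (sub n \<pi> x) - p (sub n \<pi> x))\<^sup>2)"
    by (simp only: cube_avg_add cube_avg_cmult)
  \<comment> \<open>1386483 = 3 * 640 + 3 * 9 * 51280 + 3.\<close>
  also have "\<dots> \<le> 1386483 * \<eta>" using fh \<pi>(2) q hp by linarith
  also have "\<dots> < 10 ^ 12 * \<eta>" using eta_pos by (intro mult_strict_right_mono) auto
  also have "\<dots> = \<epsilon>\<^sup>2" by (simp add: eta power_divide)
  finally have "l2_dist n f ?p < sqrt (\<epsilon>\<^sup>2)" unfolding l2_dist_cube_avg by (rule real_sqrt_less_mono)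
  then have "l2_dist n f ?p < \<epsilon>" using eps by simp
  moreover have "?p \<in> P" using property p(1) \<pi>(1) unfolding is_property_def by blast
  ultimately show ?thesis by blast
qed

text \<open>Only one of the tests has to reject. If no set of at most \<open>k\<close> coordinates
  has \<open>dev\<close> at most \<open>640 * \<eta>\<close>, the influence test does; otherwise
  \<open>f\<close> is near a junta, and acceptance by the core test would put \<open>f\<close> near
  \<open>P\<close> unless variables collide or the answers are atypical.\<close>

lemma soundness:
  assumes f: "f \<in> bfuns n" and far: "dist2 n f P \<ge> ereal \<epsilon>"
  shows "2 / 3 \<le> reject_prob tester f"
proof -
  have not_close: "\<not> (\<exists>p\<in>P. l2_dist n f p < \<epsilon>)"
  proof
    assume "\<exists>p\<in>P. l2_dist n f p < \<epsilon>"
    then obtain p where p: "p \<in> P" "l2_dist n f p < \<epsilon>" by blast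
    have "dist2 n f P \<le> ereal (l2_dist n f p)" unfolding dist2_def by (rule INF_lower[OF p(1)])
    then have "ereal \<epsilon> \<le> ereal (l2_dist n f p)" using far by (rule order_trans[rotated])
    then show False using p(2) by simp
  qed
  have "measure_pmf.prob coins {x. T1 (fst x) (snd x) f \<and> T2 (fst x) f} \<le> 1 / 10"
  proof (cases "\<exists>J\<subseteq>{..<n}. card J \<le> k \<and> dev n f J \<le> 640 * \<eta>")
    case False
    then have "640 * \<eta> < dev n f J" if "J \<subseteq> {..<n}" "card J \<le> k" for J using that by force
    from influence_test_far[OF f this]
    have "measure_pmf.prob coins {x. T1 (fst x) (snd x) f} \<le> 1 / 10" .
    moreover have "measure_pmf.prob coins {x. T1 (fst x) (snd x) f \<and> T2 (fst x) f} \<le> measure_pmf.prob coins {x. T1 (fst x) (snd x) f}"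
      by (rule prob_mono_set_pmf) simp
    ultimately show ?thesis by linarith
  next
    case True
    then obtain J where J: "J \<subseteq> {..<n}" "card J \<le> k" "dev n f J \<le> 640 * \<eta>" by blast
    obtain h where h: "depends_on n J h" "cube_avg n (\<lambda>x. (f x - h x)\<^sup>2) \<le> dev n f J"
      using dev_junta_exists[OF f, of J] by blast
    have fh: "cube_avg n (\<lambda>x. (f x - h x)\<^sup>2) \<le> 640 * \<eta>" using h(2) J(3) by linarith
    have eta': "0 < 640 * \<eta>" using eta_pos by simp
    have "measure_pmf.prob labels {\<phi>. T2 \<phi> f} \<le> 1 / 20 + 1 / 20"
    proof (rule prob_disj_le[OF _ prob_not_inj_parts[OF J(1,2) k] prob_core_samples[OF design k eta' fh]])
      fix \<phi> assume "\<phi> \<in> set_pmf labels" "T2 \<phi> f"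
      then show "\<not> inj_on \<phi> J \<or> real (design_size k) * (20 * (640 * \<eta>))
          < (\<Sum>i<design_size k. (f (sub n \<phi> (ys i)) - h (sub n \<phi> (ys i)))\<^sup>2)"
        using core_test_close[OF f J(1,2) h(1) fh] not_close unfolding labels_set not_le[symmetric] by blast
    qed
    from prob_coins_fst[OF this] have "measure_pmf.prob coins {x. T2 (fst x) f} \<le> 1 / 10" by simp
    moreover have "measure_pmf.prob coins {x. T1 (fst x) (snd x) f \<and> T2 (fst x) f} \<le> measure_pmf.prob coins {x. T2 (fst x) f}"
      by (rule prob_mono_set_pmf) simp
    ultimately show ?thesis by linarith
  qed
  then show ?thesis by (simp add: reject_prob_eq accept_prob_tester case_prod_unfold)
qed

lemma is_tester_tester: "is_tester n \<epsilon> P tester"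
  unfolding is_tester_def using valid_tester completeness soundness by blast

end

section \<open>The bound on the number of queries\<close>

definition complexity :: "nat \<Rightarrow> real" where
  "complexity k = 4 * 10 ^ 24 * real (parts k) ^ (k + 1) + real (design_size k)"

lemma complexity_ge_1: "1 \<le> k \<Longrightarrow> 1 \<le> complexity k"
proof -
  assume k: "1 \<le> k"
  have "1 \<le> parts k" using k by (simp add: parts_def Suc_le_eq)
  then have "1 \<le> real (parts k)" by simp
  then have "1 \<le> real (parts k) ^ (k + 1)" by (rule one_le_power)
  then have "1 * 1 \<le> (4 * 10 ^ 24) * real (parts k) ^ (k + 1)" by (intro mult_mono) auto
  then show ?thesis unfolding complexity_def by (simp only: mult_1 add_increasing2 of_nat_0_le_iff)
qed

text \<open>The number of parts is polynomial in \<open>k\<close>, so its power k + 2 contributes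
  order k log k to the logarithm and the factor 16^k only order k. The estimate starts at 2 because
  k log k vanishes at 1.\<close>

lemma log_complexity_bigo: "(\<lambda>k. log 2 (complexity k)) \<in> O(\<lambda>k. real k * log 2 (real k))"
proof (rule bigoI[where c=70])
  show "\<forall>\<^sub>F k in sequentially. norm (log 2 (complexity k)) \<le> 70 * norm (real k * log 2 (real k))"
  proof (rule eventually_sequentiallyI[of 2])
    fix k :: nat assume k: "2 \<le> k"
    let ?s = "real (parts k)" and ?L = "log 2 (real k)"
    have L: "1 \<le> ?L" using k by (simp add: le_log_iff)
    have s: "?s = 400 * real k ^ 3" by (simp add: parts_def)
    have "1 \<le> parts k" using k by (simp add: parts_def Suc_le_eq)
    then have s1: "1 \<le> ?s" by simp
    have ks: "real k \<le> ?s"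
    proof -
      have "real k * 1 \<le> real k * (400 * (real k * real k))" using k mult_mono[of 1 "real k" 1 "real k"] by (intro mult_left_mono) auto
      then show ?thesis by (simp add: s power3_eq_cube mult_ac)
    qed
    have a: "?s ^ (k + 1) \<le> ?s ^ (k + 2) * 16 ^ k"
    proof -
      have "?s ^ (k + 1) \<le> ?s ^ (k + 2)" using s1 by (intro power_increasing) auto
      also have "\<dots> \<le> ?s ^ (k + 2) * 16 ^ k" using s1 mult_left_mono[of 1 "16 ^ k" "?s ^ (k + 2)"] by simp
      finally show ?thesis .
    qed
    have b: "real (design_size k) \<le> 32 * (?s ^ (k + 2) * 16 ^ k)"
    proof -
      have "real k * ?s \<le> ?s * ?s" using ks by (intro mult_right_mono) auto
      also have "\<dots> = ?s ^ 2" by (simp add: power2_eq_square)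
      also have "\<dots> \<le> ?s ^ (k + 2)" using s1 by (intro power_increasing) auto
      finally have "16 ^ k * (real k * ?s) \<le> 16 ^ k * ?s ^ (k + 2)" by (intro mult_left_mono) auto
      then show ?thesis by (simp add: design_size_def mult_ac)
    qed
    have "complexity k \<le> (4 * 10 ^ 24 + 32) * (?s ^ (k + 2) * 16 ^ k)"
      unfolding complexity_def using a b by simp
    also have "\<dots> \<le> 2 ^ 84 * (?s ^ (k + 2) * 16 ^ k)" using s1 by (intro mult_right_mono) auto
    finally have C: "complexity k \<le> 2 ^ 84 * (?s ^ (k + 2) * 16 ^ k)" .
    have C1: "1 \<le> complexity k" using complexity_ge_1 k by simp
    have "log 2 (complexity k) \<le> log 2 (2 ^ 84 * (?s ^ (k + 2) * 16 ^ k))"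
      using C C1 by (intro log_mono) auto
    also have "\<dots> = 84 + (real k + 2) * log 2 ?s + 4 * real k"
    proof -
      have l16: "log 2 (16 :: real) = 4" using log_pow_cancel[of 2 4] by simp
      have l84: "log 2 ((2 :: real) ^ 84) = real 84" by (rule log_pow_cancel) auto
      have "log 2 (2 ^ 84 * (?s ^ (k + 2) * 16 ^ k)) = log 2 (2 ^ 84) + (log 2 (?s ^ (k + 2)) + log 2 (16 ^ k))"
        using s1 by (subst log_mult_pos; (subst log_mult_pos)?) auto
      also have "\<dots> = 84 + (real k + 2) * log 2 ?s + 4 * real k"
        unfolding l84 using s1 by (simp add: log_nat_power l16 add.commute del: power_Suc)
      finally show ?thesis .
    qed
    also have "log 2 ?s \<le> 12 * ?L"
    proof -
      have "log 2 ?s \<le> log 2 (2 ^ 9 * real k ^ 3)"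
        unfolding s using k by (intro log_mono) auto
      also have "\<dots> = log 2 (2 ^ 9) + 3 * ?L" using k by (simp add: log_mult_pos log_nat_power)
      also have "log 2 ((2 :: real) ^ 9) = real 9" by (rule log_pow_cancel) auto
      finally show ?thesis using L by simp
    qed
    \<comment> \<open>For k at least 2 the terms are at most 42, 12 + 12 and 4 times
      \<open>real k * ?L\<close>, in total 70.\<close>
    also have "84 + (real k + 2) * (12 * ?L) + 4 * real k \<le> 70 * (real k * ?L)"
    proof -
      have kL: "real k \<le> real k * ?L" using L mult_left_mono[of 1 ?L "real k"] by simp
      have "2 * ?L \<le> real k * ?L" using k L by (intro mult_right_mono) auto
      moreover have "84 \<le> 42 * real k" using k by simp
      moreover have "(real k + 2) * (12 * ?L) = 12 * (real k * ?L) + 24 * ?L" by (simp add: algebra_simps)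
      ultimately show ?thesis using kL by linarith
    qed
    finally have "log 2 (complexity k) \<le> 70 * (real k * ?L)" using k by simp
    moreover have "0 \<le> log 2 (complexity k)" using C1 by simp
    moreover have "0 \<le> real k * ?L" using L by simp
    ultimately show "norm (log 2 (complexity k)) \<le> 70 * norm (real k * log 2 (real k))" by simp
  qed
qed

theorem theorem3:
  shows "\<exists>g :: nat \<Rightarrow> real. g \<in> O(\<lambda>k. real k * log 2 (real k)) \<and>
    (\<forall>(n::nat) (\<epsilon>::real) (P :: bfun set) (k::nat).
       0 < \<epsilon> \<longrightarrow> \<epsilon> < 1 / 2 \<longrightarrow> is_property n P \<longrightarrow> 1 \<le> k \<longrightarrow>
       (\<forall>f\<in>P. \<exists>h\<in>bfuns n. junta n k h \<and> l2_dist n f h \<le> \<epsilon> / 10 ^ 6) \<longrightarrow>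
       (\<exists>T. is_tester n \<epsilon> P T \<and>
            query_complexity n T \<le> ereal (2 powr (g k) / \<epsilon> ^ 10)))"
proof (intro exI[of _ "\<lambda>k. log 2 (complexity k)"] conjI log_complexity_bigo allI impI)
  fix n k :: nat and \<epsilon> :: real and P :: "bfun set"
  assume \<epsilon>: "0 < \<epsilon>" "\<epsilon> < 1 / 2" and P: "is_property n P" and k: "1 \<le> k"
    and close: "\<forall>f\<in>P. \<exists>h\<in>bfuns n. junta n k h \<and> l2_dist n f h \<le> \<epsilon> / 10 ^ 6"
  obtain ys where ys: "design k ys" using design_exists[OF k] by blast
  define \<eta> where "\<eta> = (\<epsilon> / 10 ^ 6)\<^sup>2"
  define m where "m = nat \<lceil>real (parts k) / \<eta>\<^sup>2\<rceil>"
  interpret tester_setup n k \<epsilon> \<eta> P ys m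
    by unfold_locales (use \<epsilon> P k close ys in \<open>auto simp: \<eta>_def m_def real_nat_ceiling_ge\<close>)
  have s1: "1 \<le> real s" using s_pos by simp
  have e4: "\<eta>\<^sup>2 = \<epsilon> ^ 4 / 10 ^ 24" by (simp add: \<eta>_def power_divide flip: power_mult)
  have p4: "\<epsilon> ^ 4 \<le> 1" using \<epsilon> by (intro power_le_one) auto
  have p10: "\<epsilon> ^ 10 \<le> \<epsilon> ^ 4" using \<epsilon> by (intro power_decreasing) auto
  have p10': "\<epsilon> ^ 10 \<le> 1" using \<epsilon> by (intro power_le_one) auto
  have pos: "0 < \<epsilon> ^ 10" "0 < \<epsilon> ^ 4" using \<epsilon> by simp_all
  have "real s / \<eta>\<^sup>2 = 10 ^ 24 * real s / \<epsilon> ^ 4" by (simp add: e4)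
  also have "\<dots> \<le> 10 ^ 24 * real s / \<epsilon> ^ 10"
    using p10 pos by (intro divide_left_mono) auto
  finally have sm: "real s / \<eta>\<^sup>2 \<le> 10 ^ 24 * real s / \<epsilon> ^ 10" .
  have "1 \<le> 10 ^ 24 * real s / \<epsilon> ^ 10" using p10' pos s1 by (simp add: field_simps)
  moreover have "real m \<le> real s / \<eta>\<^sup>2 + 1"
  proof -
    have "0 \<le> real s / \<eta>\<^sup>2" by simp
    then have "0 \<le> \<lceil>real s / \<eta>\<^sup>2\<rceil>" by linarith
    then have "real m = of_int \<lceil>real s / \<eta>\<^sup>2\<rceil>" unfolding m_def by (simp only: of_nat_nat)
    then show ?thesis using of_int_ceiling_le_add_one[of "real s / \<eta>\<^sup>2"] by linarith
  qed
  \<comment> \<open>The extra 1 from rounding up is absorbed by doubling. Together with the 2 in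
    \<open>cb\<close> this gives the leading 4 in \<open>complexity\<close>.\<close>
  ultimately have mb: "real m \<le> 2 * 10 ^ 24 * real s / \<epsilon> ^ 10" using sm by linarith
  have cb: "1 + real (s choose k) \<le> 2 * real s ^ k"
  proof -
    have "s choose k \<le> s ^ k" using k_le_s by (intro binomial_le_pow) simp
    then have "real (s choose k) \<le> real (s ^ k)" by (rule of_nat_mono)
    then have "real (s choose k) \<le> real s ^ k" by (simp only: of_nat_power)
    moreover have "1 \<le> real s ^ k" using s1 by (rule one_le_power)
    ultimately show ?thesis by linarith
  qed
  have "real (m * (1 + (s choose k)) + design_size k)
      = real m * (1 + real (s choose k)) + real (design_size k)" by (simp add: algebra_simps)
  also have "\<dots> \<le> (2 * 10 ^ 24 * real s / \<epsilon> ^ 10) * (2 * real s ^ k) + real (design_size k) / \<epsilon> ^ 10"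
  proof (intro add_mono mult_mono mb cb)
    show "real (design_size k) \<le> real (design_size k) / \<epsilon> ^ 10"
      using p10' pos mult_left_mono[OF p10', of "real (design_size k)"] by (simp add: pos_le_divide_eq)
  qed (use pos in auto)
  also have "\<dots> = complexity k / \<epsilon> ^ 10"
    by (simp add: complexity_def add_divide_distrib)
  also have "complexity k = 2 powr (log 2 (complexity k))"
    using complexity_ge_1[OF k] by simp
  finally have "real (m * (1 + (s choose k)) + design_size k) \<le> 2 powr (log 2 (complexity k)) / \<epsilon> ^ 10" .
  then have "query_complexity n tester \<le> ereal (2 powr (log 2 (complexity k)) / \<epsilon> ^ 10)"
    using query_complexity_tester order_trans by (metis ereal_less_eq(3))
  then show "\<exists>T. is_tester n \<epsilon> P T \<and> query_complexity n T \<le> ereal (2 powr (log 2 (complexity k)) / \<epsilon> ^ 10)"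
    using is_tester_tester by blast
qed

end
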